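(* Any metric space induced by a connected graph on $n$ vertices with diameter at most $D$ has at least $(2^{-7/3} - o(1))(n/D)^{4/3}$ distinct lines, where $o(1) \to 0$ as $n/D \to \infty$.
   Context: The metric induced by a connected graph $G$ on vertex set $V$ is $\rho(u,v)=$ length of a shortest $u$–$v$ path; the diameter is $\max_{u,v}\rho(u,v)$. For distinct points $a,b,c$ write $[abc]$ if $\rho(a,c) = \rho(a,b)+\rho(b,c)$; $\{a,b,c\}$ is collinear if one of $[abc],[bca],[cab]$ holds. For distinct $a,b$, the line $\overline{ab}$ is $\{a,b\}$ together with all $c$ such that $\{a,b,c\}$ is collinear. *)

theory Defs
  imports Complex_Main "Graph_Theory.Graph_Theory"
begin

(* Graphs are the library's pair_graph: finite, loop-free, with a symmetric set of ordered
   pairs as edges. In a connected graph the Inf below is over a nonempty set of naturals,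
   hence a minimum. *)
definition graph_dist :: "'a pair_pre_digraph \<Rightarrow> 'a \<Rightarrow> 'a \<Rightarrow> nat" where
  "graph_dist G u v = Inf {length p | p. pre_digraph.apath (with_proj G) u p v}"

definition graph_diameter :: "'a pair_pre_digraph \<Rightarrow> nat" where
  "graph_diameter G = Max {graph_dist G u v | u v. u \<in> pverts G \<and> v \<in> pverts G}"

definition between :: "('a \<Rightarrow> 'a \<Rightarrow> nat) \<Rightarrow> 'a \<Rightarrow> 'a \<Rightarrow> 'a \<Rightarrow> bool" where
  "between \<rho> a b c \<longleftrightarrow>
     a \<noteq> b \<and> b \<noteq> c \<and> a \<noteq> c \<and> \<rho> a c = \<rho> a b + \<rho> b c"

definition metric_collinear :: "('a \<Rightarrow> 'a \<Rightarrow> nat) \<Rightarrow> 'a \<Rightarrow> 'a \<Rightarrow> 'a \<Rightarrow> bool" where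
  "metric_collinear \<rho> a b c \<longleftrightarrow>
     between \<rho> a b c \<or> between \<rho> b c a \<or> between \<rho> c a b"

definition metric_line :: "'a set \<Rightarrow> ('a \<Rightarrow> 'a \<Rightarrow> nat) \<Rightarrow> 'a \<Rightarrow> 'a \<Rightarrow> 'a set" where
  "metric_line V \<rho> a b = {a, b} \<union> {c \<in> V. metric_collinear \<rho> a b c}"

definition metric_lines :: "'a set \<Rightarrow> ('a \<Rightarrow> 'a \<Rightarrow> nat) \<Rightarrow> 'a set set" where
  "metric_lines V \<rho> = {metric_line V \<rho> a b | a b. a \<in> V \<and> b \<in> V \<and> a \<noteq> b}"

end

(* Call two pairs of points at the same distance equivalent if they generate the same line. Since
   the metric comes from a graph, every interval contains points at all intermediate distances, and
   for non-adjacent pairs this rules out "parallel" equivalent pairs. An equivalence class then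
   consists either of antipodal pairs (each pair lying in the interval of the other), or of segments
   arranged around a fixed one, where the segments in the same position have their far ends in
   general position. As k points in general position generate k(k-1)/2 lines, N lines come from at
   most about D^2 N sqrt(2N) unordered non-adjacent pairs.
   If at least n^2/8 pairs are non-adjacent, this gives the bound. Otherwise at least half of the
   points are mutually at distance at most 2, and these points contain a clique of size of order
   n^2/N, whose pairs generate distinct lines. *)

theory Submission
  imports Defs "HOL-Real_Asymp.Real_Asymp"
begin

section \<open>Pairs generating the same line\<close>

text \<open>The constant comes from the non-adjacent pairs alone: with \<open>N\<close> lines and
  \<open>t = n/D\<close>, \<open>n^2/4\<close> ordered pairs against about
  \<open>2 D^2 N sqrt(2N)\<close> give \<open>N^(3/2) >= 2^(-7/2) t^2\<close> up to lower order. The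
  clique case loses constant factors, but its bound is in terms of \<open>n\<close>, and
  \<open>n = t D >= 3 t\<close> for \<open>D >= 3\<close> supplies a spare factor
  \<open>3^(4/3)\<close>. The clique constant 17 has to fit into this gain; \<open>D = 1\<close> and
  \<open>D = 2\<close> are treated directly. Antipodal classes are the obstacle in the pair count,
  as no coordinate along the line separates their pairs. They are bounded indirectly: pairs of
  endpoints taken from different antipodal pairs generate many lines, because for length at least 2
  their own classes are not antipodal. The leading constant has to survive for every fixed
  \<open>D\<close>, so the other pairs are counted with \<open>(D - 1)^2\<close> in place of
  \<open>D^2\<close>, and the difference pays for the antipodal ones.\<close>

locale geodesic_metric =
  fixes V :: "'a set" and \<rho> :: "'a \<Rightarrow> 'a \<Rightarrow> nat" and D :: nat
  assumes finite_V: "finite V"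
    and dist_eq_0: "x \<in> V \<Longrightarrow> y \<in> V \<Longrightarrow> \<rho> x y = 0 \<longleftrightarrow> x = y"
    and dist_sym: "x \<in> V \<Longrightarrow> y \<in> V \<Longrightarrow> \<rho> x y = \<rho> y x"
    and dist_triangle: "x \<in> V \<Longrightarrow> y \<in> V \<Longrightarrow> z \<in> V \<Longrightarrow> \<rho> x z \<le> \<rho> x y + \<rho> y z"
    and dist_step: "x \<in> V \<Longrightarrow> y \<in> V \<Longrightarrow> x \<noteq> y \<Longrightarrow>
      \<exists>z\<in>V. \<rho> x z = 1 \<and> \<rho> x y = Suc (\<rho> z y)"
    and dist_le_diam: "x \<in> V \<Longrightarrow> y \<in> V \<Longrightarrow> \<rho> x y \<le> D"
begin

section \<open>Elementary facts on metric lines\<close>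

abbreviation line :: "'a \<Rightarrow> 'a \<Rightarrow> 'a set" where
  "line \<equiv> metric_line V \<rho>"

abbreviation lines :: "'a set set" where
  "lines \<equiv> metric_lines V \<rho>"

text \<open>The endpoints satisfy the equations as well, so the distinctness conditions of
  collinearity disappear and membership becomes linear arithmetic on distances.\<close>

lemma mem_line:
  assumes "a \<in> V" "b \<in> V" "a \<noteq> b" "z \<in> V"
  shows "z \<in> line a b \<longleftrightarrow>
    \<rho> a z + \<rho> z b = \<rho> a b \<or> \<rho> a z = \<rho> a b + \<rho> b z \<or> \<rho> b z = \<rho> a b + \<rho> a z"
proof -
  have eqs: "\<rho> z a = \<rho> a z" "\<rho> z b = \<rho> b z" "\<rho> b a = \<rho> a b"
    using assms dist_sym by auto
  show ?thesis
  proof (cases "z = a \<or> z = b")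
    case True
    then show ?thesis
      using assms dist_eq_0[of a a] dist_eq_0[of b b] eqs by (auto simp: metric_line_def)
  next
    case False
    then show ?thesis
      using assms eqs by (auto simp: metric_line_def metric_collinear_def between_def)
  qed
qed

lemma line_subset: "a \<in> V \<Longrightarrow> b \<in> V \<Longrightarrow> line a b \<subseteq> V"
  by (auto simp: metric_line_def)

lemma ends_in_line: "a \<in> line a b" "b \<in> line a b"
  by (auto simp: metric_line_def)

lemma line_in_lines: "a \<in> V \<Longrightarrow> b \<in> V \<Longrightarrow> a \<noteq> b \<Longrightarrow> line a b \<in> lines"
  by (auto simp: metric_lines_def)

lemma line_commute: "a \<in> V \<Longrightarrow> b \<in> V \<Longrightarrow> line a b = line b a"
proof -
  assume ab: "a \<in> V" "b \<in> V"
  have "z \<in> line a b \<longleftrightarrow> z \<in> line b a" if "a \<noteq> b" "z \<in> V" for z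
    using mem_line[of a b z] mem_line[of b a z] ab that dist_sym[of a b] dist_sym[of a z]
      dist_sym[of b z] by auto
  then show ?thesis
    using line_subset[of a b] line_subset[of b a] ab by (cases "a = b") auto
qed

lemma finite_lines: "finite lines"
proof -
  have "lines \<subseteq> (\<lambda>(a, b). line a b) ` (V \<times> V)"
    by (auto simp: metric_lines_def)
  then show ?thesis
    using finite_V by (meson finite_SigmaI finite_imageI finite_subset)
qed

lemma in_same_line:
  assumes "a \<in> V" "b \<in> V" "a \<noteq> b" "c \<in> V" "d \<in> V" "line c d = line a b"
  shows "\<rho> a c + \<rho> b c = \<rho> a b \<or> \<rho> a c = \<rho> a b + \<rho> b c \<or> \<rho> b c = \<rho> a b + \<rho> a c"
    "\<rho> a d + \<rho> b d = \<rho> a b \<or> \<rho> a d = \<rho> a b + \<rho> b d \<or> \<rho> b d = \<rho> a b + \<rho> a d"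
proof -
  have "c \<in> line a b" "d \<in> line a b"
    using ends_in_line[of c d] ends_in_line[of d c] assms by auto
  then show
    "\<rho> a c + \<rho> b c = \<rho> a b \<or> \<rho> a c = \<rho> a b + \<rho> b c \<or> \<rho> b c = \<rho> a b + \<rho> a c"
    "\<rho> a d + \<rho> b d = \<rho> a b \<or> \<rho> a d = \<rho> a b + \<rho> b d \<or> \<rho> b d = \<rho> a b + \<rho> a d"
    using mem_line[of a b c] mem_line[of a b d] assms dist_sym[of b c] dist_sym[of b d] by auto
qed

text \<open>The four points would form a rectangle with sides \<open>i\<close>, \<open>t\<close> and
  both diagonals \<open>i + t\<close>. The first point \<open>v\<close> after \<open>a\<close> on a
  geodesic to \<open>b\<close> then has distances \<open>i - 1 + t\<close> and \<open>t + 1\<close>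
  to \<open>c\<close> and \<open>d\<close>, which fits no collinear order once
  \<open>2 \<le> i\<close>. For \<open>i = 1\<close> opposite edges of a 4-cycle are such a
  rectangle.\<close>

lemma same_line_not_parallel:
  assumes V: "a \<in> V" "b \<in> V" "c \<in> V" "d \<in> V"
    and i: "\<rho> a b = i" "\<rho> c d = i" "2 \<le> i" and eq: "line c d = line a b"
    and t: "\<rho> a d = t" "\<rho> b c = t" "0 < t"
  shows "\<not> (\<rho> a c = i + t \<and> \<rho> b d = i + t)"
proof
  assume *: "\<rho> a c = i + t \<and> \<rho> b d = i + t"
  have ne: "a \<noteq> b" "c \<noteq> d" using V i dist_eq_0 by force+
  obtain v where v: "v \<in> V" "\<rho> a v = 1" "\<rho> a b = Suc (\<rho> v b)"
    using dist_step[of a b] V ne by blast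
  have "v \<in> line a b" using mem_line[of a b v] V ne v by auto
  then have "v \<in> line c d" using eq by simp
  then have "\<rho> c v + \<rho> v d = \<rho> c d \<or> \<rho> c v = \<rho> c d + \<rho> d v \<or> \<rho> d v = \<rho> c d + \<rho> c v"
    using mem_line[of c d v] V ne v by auto
  moreover have "\<rho> a c \<le> \<rho> a v + \<rho> v c" "\<rho> v c \<le> \<rho> v b + \<rho> b c"
    "\<rho> v d \<le> \<rho> a v + \<rho> a d" "\<rho> b d \<le> \<rho> v b + \<rho> v d"
    using V v dist_triangle[of a v c] dist_triangle[of v b c] dist_triangle[of v a d]
      dist_triangle[of b v d] dist_sym[of v a] dist_sym[of v b] by auto
  moreover have "\<rho> v c = \<rho> c v" "\<rho> v d = \<rho> d v" using V v dist_sym by auto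
  ultimately show False using * i t v by linarith
qed

text \<open>Position on the line through \<open>a\<close> and \<open>b\<close>, with \<open>a\<close> at the origin and \<open>b\<close> at
  \<open>\<rho> a b\<close>.\<close>

definition coord :: "'a \<Rightarrow> 'a \<Rightarrow> 'a \<Rightarrow> int" where
  "coord a b z = (if \<rho> b z = \<rho> a b + \<rho> a z then - int (\<rho> a z) else int (\<rho> a z))"

text \<open>Membership is used both ways: \<open>c\<close>, \<open>d\<close> on the line of
  \<open>a\<close>, \<open>b\<close>, and \<open>a\<close>, \<open>b\<close> on the line of
  \<open>c\<close>, \<open>d\<close>. The hypothesis \<open>nc\<close> excludes the antipodal case,
  in which the two coordinates add up to \<open>i\<close> instead of differing by
  \<open>i\<close>.\<close>

lemma coord_diff:
  assumes V: "a \<in> V" "b \<in> V" "c \<in> V" "d \<in> V"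
    and i: "\<rho> a b = i" "\<rho> c d = i" "2 \<le> i" and eq: "line c d = line a b"
    and nc: "\<not> (c \<notin> {a, b} \<and> d \<notin> {a, b} \<and> \<rho> a c + \<rho> b c = i \<and> \<rho> a d + \<rho> b d = i)"
  shows "coord a b d = coord a b c + int i \<or> coord a b c = coord a b d + int i"
proof -
  have ne: "a \<noteq> b" "c \<noteq> d" using V i dist_eq_0 by force+
  note 1 = in_same_line[of a b c d] and 2 = in_same_line[of c d a b]
  have s: "\<rho> c a = \<rho> a c" "\<rho> d a = \<rho> a d" "\<rho> c b = \<rho> b c" "\<rho> d b = \<rho> b d" "\<rho> b a = \<rho> a b"
    "\<rho> d c = \<rho> c d" using V dist_sym by auto
  have z: "\<rho> a a = 0" "\<rho> b b = 0" using V dist_eq_0 by auto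
  consider "c = a" | "c = b" | "d = a" | "d = b" | "c \<notin> {a, b} \<and> d \<notin> {a, b}" by blast
  then show ?thesis
  proof cases
    case 5
    have pos: "0 < \<rho> a c" "0 < \<rho> a d" "0 < \<rho> b c" "0 < \<rho> b d"
      using 5 V dist_eq_0 by (metis gr0I insertCI)+
    have A: "\<rho> a c + \<rho> b c = i \<or> \<rho> a c = i + \<rho> b c \<or> \<rho> b c = i + \<rho> a c"
      "\<rho> a d + \<rho> b d = i \<or> \<rho> a d = i + \<rho> b d \<or> \<rho> b d = i + \<rho> a d"
      using 1 V ne i eq by auto
    have B: "\<rho> a c + \<rho> a d = i \<or> \<rho> a c = i + \<rho> a d \<or> \<rho> a d = i + \<rho> a c"
      "\<rho> b c + \<rho> b d = i \<or> \<rho> b c = i + \<rho> b d \<or> \<rho> b d = i + \<rho> b c"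
      using 2 V ne i eq s by auto
    have C: "\<not> (\<rho> a c = i + \<rho> b c \<and> \<rho> b d = i + \<rho> a d \<and> \<rho> a d = \<rho> b c)"
      using same_line_not_parallel[of a b c d i "\<rho> b c"] V i eq pos by auto
    have C': "\<not> (\<rho> a d = i + \<rho> b d \<and> \<rho> b c = i + \<rho> a c \<and> \<rho> a c = \<rho> b d)"
      using same_line_not_parallel[of a b d c i "\<rho> b d"] V i eq pos line_commute[of c d] s by auto
    have nc': "\<not> (\<rho> a c + \<rho> b c = i \<and> \<rho> a d + \<rho> b d = i)" using nc 5 by auto
    have coord_in: "coord a b x = int (\<rho> a x)" if "\<rho> b x \<noteq> i + \<rho> a x" for x
      using that i by (simp add: coord_def)
    have coord_out: "coord a b x = - int (\<rho> a x)" if "\<rho> b x = i + \<rho> a x" for x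
      using that i by (simp add: coord_def)
    consider (mid_right) "\<rho> a c + \<rho> b c = i" "\<rho> a d = i + \<rho> b d"
      | (mid_left) "\<rho> a c + \<rho> b c = i" "\<rho> b d = i + \<rho> a d"
      | (right_mid) "\<rho> a c = i + \<rho> b c" "\<rho> a d + \<rho> b d = i"
      | (left_mid) "\<rho> b c = i + \<rho> a c" "\<rho> a d + \<rho> b d = i"
      | (right) "\<rho> a c = i + \<rho> b c" "\<rho> a d = i + \<rho> b d"
      | (left) "\<rho> b c = i + \<rho> a c" "\<rho> b d = i + \<rho> a d"
      | (right_left) "\<rho> a c = i + \<rho> b c" "\<rho> b d = i + \<rho> a d"
      | (left_right) "\<rho> b c = i + \<rho> a c" "\<rho> a d = i + \<rho> b d"
      using A nc' by blast
    then show ?thesis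
    proof cases
      case mid_right
      have "\<rho> a d = \<rho> a c + i" using mid_right B pos by linarith
      then show ?thesis using coord_in[of c] coord_in[of d] mid_right pos i by linarith
    next
      case mid_left
      have "\<rho> a c + \<rho> a d = i" using mid_left B pos by linarith
      then show ?thesis using coord_in[of c] coord_out[of d] mid_left pos i by linarith
    next
      case right_mid
      have "\<rho> a c = \<rho> a d + i" using right_mid B pos by linarith
      then show ?thesis using coord_in[of c] coord_in[of d] right_mid pos i by linarith
    next
      case left_mid
      have "\<rho> a c + \<rho> a d = i" using left_mid B pos by linarith
      then show ?thesis using coord_out[of c] coord_in[of d] left_mid pos i by linarith
    next
      case right
      have "\<rho> a c = i + \<rho> a d \<or> \<rho> a d = i + \<rho> a c" using right B pos by linarith
      then show ?thesis using coord_in[of c] coord_in[of d] right pos i by linarith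
    next
      case left
      have "\<rho> a c = i + \<rho> a d \<or> \<rho> a d = i + \<rho> a c" using left B pos by linarith
      then show ?thesis using coord_out[of c] coord_out[of d] left pos i by linarith
    next
      \<comment> \<open>With \<open>c\<close> beyond \<open>b\<close> and \<open>d\<close> beyond
        \<open>a\<close>, the equations \<open>B\<close> force
        \<open>\<rho> a d = \<rho> b c\<close>: the forbidden rectangle.\<close>
      case right_left
      then show ?thesis using B C pos i by linarith
    next
      case left_right
      then show ?thesis using B C' pos i by linarith
    qed
  qed (use 1 2 V ne i eq s z dist_eq_0[of a b] dist_eq_0[of b d] dist_eq_0[of b c] dist_eq_0[of a c] dist_eq_0[of a d]
      in \<open>auto simp: coord_def\<close>)
qed

text \<open>If \<open>z\<close> were beyond \<open>b\<close>, then \<open>b\<close> would lie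
  between \<open>z\<close> and each of \<open>c\<close>, \<open>d\<close>. The distances from
  \<open>z\<close> to \<open>c\<close> and \<open>d\<close> would then sum to more than
  \<open>i\<close> and differ by less than \<open>i\<close>, so \<open>z\<close> would be off their
  line. Hence a pair whose line leaves its interval has no antipodal partner, and
  \<open>coord_diff\<close> applies to all pairs of its length generating that line.\<close>

lemma antipodal_not_extendable:
  assumes V: "a \<in> V" "b \<in> V" "c \<in> V" "d \<in> V"
    and i: "\<rho> a b = i" "\<rho> c d = i" and eq: "line c d = line a b"
    and c: "\<rho> a c + \<rho> b c = i" "\<rho> a d + \<rho> b d = i" "c \<notin> {a, b}" "d \<notin> {a, b}" "a \<noteq> b"
    and z: "z \<in> line a b"
  shows "\<rho> a z + \<rho> b z = i"
proof -
  have zV: "z \<in> V" using z line_subset V by auto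
  have ne: "c \<noteq> d" using V i c(5) dist_eq_0 by metis
  have s: "\<rho> c a = \<rho> a c" "\<rho> d a = \<rho> a d" "\<rho> c b = \<rho> b c" "\<rho> d b = \<rho> b d" "\<rho> b a = \<rho> a b"
    "\<rho> d c = \<rho> c d" "\<rho> z a = \<rho> a z" "\<rho> z b = \<rho> b z" "\<rho> z c = \<rho> c z" "\<rho> z d = \<rho> d z"
    using V zV dist_sym by auto
  have pos: "0 < \<rho> a c" "0 < \<rho> a d" "0 < \<rho> b c" "0 < \<rho> b d"
    using c V dist_eq_0 by (metis gr0I insertCI)+
  have Z: "\<rho> a z + \<rho> b z = i \<or> \<rho> a z = i + \<rho> b z \<or> \<rho> b z = i + \<rho> a z"
    using mem_line[of a b z] V zV z c i s by auto
  have Z': "\<rho> c z + \<rho> d z = i \<or> \<rho> c z = i + \<rho> d z \<or> \<rho> d z = i + \<rho> c z"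
    using mem_line[of c d z] V zV z ne i s eq by auto
  have B: "\<rho> a c + \<rho> a d = i \<or> \<rho> a c = i + \<rho> a d \<or> \<rho> a d = i + \<rho> a c"
    "\<rho> b c + \<rho> b d = i \<or> \<rho> b c = i + \<rho> b d \<or> \<rho> b d = i + \<rho> b c"
    using in_same_line[of c d a b] V ne i eq s by auto
  have t: "\<rho> b z \<le> \<rho> b c + \<rho> c z" "\<rho> b z \<le> \<rho> b d + \<rho> d z" "\<rho> a z \<le> \<rho> a c + \<rho> c z"
    "\<rho> a z \<le> \<rho> a d + \<rho> d z" "\<rho> c z \<le> \<rho> a c + \<rho> a z" "\<rho> d z \<le> \<rho> a d + \<rho> a z"
    "\<rho> c z \<le> \<rho> b c + \<rho> b z" "\<rho> d z \<le> \<rho> b d + \<rho> b z"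
    using V zV dist_triangle[of b c z] dist_triangle[of b d z] dist_triangle[of a c z]
      dist_triangle[of a d z] dist_triangle[of c a z] dist_triangle[of d a z]
      dist_triangle[of c b z] dist_triangle[of d b z] s by auto
  have e: "\<rho> b d = \<rho> a c" "\<rho> b c = \<rho> a d" "\<rho> a c + \<rho> a d = i"
    using B c pos by linarith+
  show ?thesis using Z Z' t e pos by linarith
qed

section \<open>Point sets in general position\<close>

definition general_position :: "'a set \<Rightarrow> bool" where
  "general_position S \<longleftrightarrow>
    (\<forall>x\<in>S. \<forall>y\<in>S. \<forall>z\<in>S. x \<noteq> y \<longrightarrow> y \<noteq> z \<longrightarrow> x \<noteq> z \<longrightarrow> \<rho> x z \<noteq> \<rho> x y + \<rho> y z)"

text \<open>A line through two points of \<open>S\<close> meets \<open>S\<close> in just these two,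
  so different pairs give different lines.\<close>

lemma general_position_choose_two:
  assumes "S \<subseteq> V" "general_position S"
  shows "card S choose 2 \<le> card lines"
proof -
  have "line x y \<inter> S = {x, y}" if xy: "x \<in> S" "y \<in> S" "x \<noteq> y" for x y
  proof -
    have "z = x \<or> z = y" if "z \<in> line x y" "z \<in> S" for z
    proof (rule ccontr)
      assume "\<not> (z = x \<or> z = y)"
      moreover have "\<rho> y z = \<rho> z y" "\<rho> x y = \<rho> y x" "\<rho> x z = \<rho> z x"
        using that xy assms(1) dist_sym by blast+
      ultimately show False
        using mem_line[of x y z] that xy assms unfolding general_position_def
        by (metis subsetD)
    qed
    then show ?thesis using ends_in_line[of x y] ends_in_line[of y x] xy by auto
  qed
  then have "B \<in> (\<lambda>l. l \<inter> S) ` lines" if "B \<subseteq> S" "card B = 2" for B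
    using that assms(1) line_in_lines unfolding card_2_iff
    by (metis image_eqI insert_subset subsetD)
  then have "{B. B \<subseteq> S \<and> card B = 2} \<subseteq> (\<lambda>l. l \<inter> S) ` lines" by blast
  then have "card {B. B \<subseteq> S \<and> card B = 2} \<le> card ((\<lambda>l. l \<inter> S) ` lines)"
    by (intro card_mono finite_imageI finite_lines)
  also have "\<dots> \<le> card lines" by (intro card_image_le finite_lines)
  finally show ?thesis
    using n_subsets[of S 2] finite_subset[OF assms(1) finite_V] by simp
qed

section \<open>Generators in the same position along a line\<close>

lemma coord_int:
  assumes "a \<in> V" "b \<in> V" "a \<noteq> b" "z \<in> line a b" "coord a b z = int p"
  shows "\<rho> a z = p" "p \<le> \<rho> a b \<Longrightarrow> \<rho> b z = \<rho> a b - p" "\<rho> a b \<le> p \<Longrightarrow> \<rho> b z = p - \<rho> a b"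
proof -
  have zV: "z \<in> V" using assms line_subset by blast
  have "\<rho> a z + \<rho> b z = \<rho> a b \<or> \<rho> a z = \<rho> a b + \<rho> b z \<or> \<rho> b z = \<rho> a b + \<rho> a z"
    using mem_line[of a b z] assms zV dist_sym[of b z] by auto
  then show "\<rho> a z = p" "p \<le> \<rho> a b \<Longrightarrow> \<rho> b z = \<rho> a b - p" "\<rho> a b \<le> p \<Longrightarrow> \<rho> b z = p - \<rho> a b"
    using assms(5) by (auto simp: coord_def split: if_splits)
qed

lemma coord_swap:
  assumes "a \<in> V" "b \<in> V" "a \<noteq> b" "z \<in> line a b"
  shows "coord b a z = int (\<rho> a b) - coord a b z"
proof -
  have zV: "z \<in> V" using assms line_subset by blast
  have "0 < \<rho> a b" "\<rho> b a = \<rho> a b" using assms dist_eq_0[of a b] dist_sym by auto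
  moreover have "\<rho> a z + \<rho> b z = \<rho> a b \<or> \<rho> a z = \<rho> a b + \<rho> b z \<or> \<rho> b z = \<rho> a b + \<rho> a z"
    using mem_line[of a b z] assms zV dist_sym[of b z] by auto
  ultimately show ?thesis by (auto simp: coord_def)
qed

text \<open>Walking away from \<open>b\<close> along the line, one cannot jump from the side of \<open>c\<close> to the side
  of \<open>d\<close>: a step changes the difference of the distances to \<open>c\<close> and \<open>d\<close> by at most two.\<close>

lemma side_constant:
  assumes V: "a \<in> V" "b \<in> V" "c \<in> V" "d \<in> V" "e \<in> V" "v \<in> V"
    and i: "\<rho> a b = i" "\<rho> c d = i" "2 \<le> i" and eq: "line c d = line a b"
    and p: "\<rho> a d = p + i" "\<rho> a e = p" "\<rho> b e + i = p"
    and v: "\<rho> a v + \<rho> v e = p" "\<rho> b v + \<rho> v e + i = p" "\<rho> d v = \<rho> c v + i"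
  shows "\<rho> d e = \<rho> c e + i"
  using V(6) v
proof (induction "\<rho> v e" arbitrary: v)
  case 0
  then have "v = e" using dist_eq_0 V by metis
  then show ?case using 0 by simp
next
  case (Suc n)
  have ne: "a \<noteq> b" "c \<noteq> d" using V i dist_eq_0[of a b] dist_eq_0[of c d] by auto
  have "v \<noteq> e" using Suc.hyps(2) dist_eq_0[of v e] V Suc.prems(1) by auto
  then obtain w where w: "w \<in> V" "\<rho> v w = 1" "\<rho> v e = Suc (\<rho> w e)"
    using dist_step[of v e] V Suc.prems(1) by blast
  have s: "\<rho> w v = \<rho> v w" "\<rho> e w = \<rho> w e" "\<rho> w d = \<rho> d w" "\<rho> b w = \<rho> w b"
    using w V Suc.prems(1) dist_sym by auto
  have t: "\<rho> a w \<le> \<rho> a v + \<rho> v w" "\<rho> b w \<le> \<rho> b v + \<rho> v w" "\<rho> a e \<le> \<rho> a w + \<rho> w e"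
    "\<rho> b e \<le> \<rho> b w + \<rho> w e" "\<rho> a d \<le> \<rho> a w + \<rho> w d" "\<rho> c w \<le> \<rho> c v + \<rho> v w"
    "\<rho> d v \<le> \<rho> d w + \<rho> w v"
    using w(1) V Suc.prems(1) dist_triangle by auto
  have aw: "\<rho> a w + \<rho> w e = p" "\<rho> b w + \<rho> w e + i = p"
    using t w p Suc.prems by linarith+
  then have "w \<in> line a b" using mem_line[of a b w] V w ne i by auto
  then have "w \<in> line c d" using eq by simp
  then have "\<rho> c w + \<rho> w d = i \<or> \<rho> c w = i + \<rho> d w \<or> \<rho> d w = i + \<rho> c w"
    using mem_line[of c d w] V w ne i by auto
  \<comment> \<open>Passing to the other side would change the difference by \<open>2 * i\<close>,
    more than two. If \<open>w\<close> were between \<open>c\<close> and \<open>d\<close>, then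
    \<open>\<rho> a d = p + i\<close> would give \<open>\<rho> d w \<ge> i\<close>, leaving only
    \<open>w = c\<close>, where the equation holds too.\<close>
  then have "\<rho> d w = \<rho> c w + i"
    using t s w p Suc.prems aw i by linarith
  then show ?case
    using Suc.hyps(1)[of w] Suc.hyps(2) w aw by simp
qed

text \<open>The far ends lie \<open>p\<close> beyond \<open>b\<close>, and paths through
  \<open>b\<close> give \<open>\<rho> c d' = \<rho> c' d = i\<close>. A second pair would then need
  \<open>\<rho> c c' = 2 * i\<close> or \<open>\<rho> d d' = 2 * i\<close>, but the detours through
  \<open>a\<close> and through \<open>b\<close> have length \<open>2 * p < 2 * i\<close>.\<close>

lemma coord_fiber_narrow:
  assumes V: "a \<in> V" "b \<in> V" "c \<in> V" "d \<in> V" "c' \<in> V" "d' \<in> V"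
    and i: "\<rho> a b = i" "\<rho> c d = i" "\<rho> c' d' = i" "2 \<le> i"
    and eq: "line c d = line a b" "line c' d' = line a b"
    and p: "p < i" "coord a b c = int p" "coord a b c' = int p"
      "coord a b d = int (p + i)" "coord a b d' = int (p + i)"
  shows "c = c' \<and> d = d'"
proof -
  have ne: "a \<noteq> b" "c \<noteq> d" "c' \<noteq> d'"
    using V i dist_eq_0[of a b] dist_eq_0[of c d] dist_eq_0[of c' d'] by auto
  have L: "c \<in> line a b" "d \<in> line a b" "c' \<in> line a b" "d' \<in> line a b"
    using eq ends_in_line by metis+
  have A: "\<rho> a c = p" "\<rho> b c = i - p" "\<rho> a c' = p" "\<rho> b c' = i - p"
    "\<rho> a d = p + i" "\<rho> b d = p" "\<rho> a d' = p + i" "\<rho> b d' = p"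
    using coord_int[OF V(1,2) ne(1) L(1) p(2)] coord_int[OF V(1,2) ne(1) L(2) p(4)]
      coord_int[OF V(1,2) ne(1) L(3) p(3)] coord_int[OF V(1,2) ne(1) L(4) p(5)] p(1) i by auto
  have s: "\<rho> c a = \<rho> a c" "\<rho> d a = \<rho> a d" "\<rho> c b = \<rho> b c" "\<rho> d b = \<rho> b d"
    "\<rho> c' a = \<rho> a c'" "\<rho> c' b = \<rho> b c'" "\<rho> d' a = \<rho> a d'" "\<rho> d' b = \<rho> b d'"
    "\<rho> d c' = \<rho> c' d" "\<rho> d' c = \<rho> c d'" "\<rho> c' c = \<rho> c c'" "\<rho> d' d = \<rho> d d'"
    using V dist_sym by auto
  have t: "\<rho> c d' \<le> \<rho> c b + \<rho> b d'" "\<rho> c' d \<le> \<rho> c' b + \<rho> b d" "\<rho> a d' \<le> \<rho> a c + \<rho> c d'"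
    "\<rho> a d \<le> \<rho> a c' + \<rho> c' d" "\<rho> c c' \<le> \<rho> c a + \<rho> a c'" "\<rho> d d' \<le> \<rho> d b + \<rho> b d'"
    using V dist_triangle by auto
  have e: "\<rho> c d' = i" "\<rho> c' d = i" using t A s p by linarith+
  have "\<rho> c c' + \<rho> d c' = i \<or> \<rho> c c' = i + \<rho> d c' \<or> \<rho> d c' = i + \<rho> c c'"
    "\<rho> c d' + \<rho> d d' = i \<or> \<rho> c d' = i + \<rho> d d' \<or> \<rho> d d' = i + \<rho> c d'"
    using in_same_line[of c d c' d'] V ne i eq by auto
  then have "\<rho> c c' = 0" "\<rho> d d' = 0" using e s t A p by linarith+
  then show ?thesis using dist_eq_0 V by blast
qed

text \<open>Walking from \<open>b\<close> to \<open>c'\<close> keeps \<open>d\<close> farther away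
  than \<open>c\<close> by \<open>i\<close>, and symmetrically for the other pair, so
  \<open>\<rho> c d' = \<rho> c' d = i + \<rho> c c'\<close>. Since \<open>d'\<close> is on the line
  of \<open>c\<close>, \<open>d\<close>, either the pairs are parallel or \<open>d\<close>,
  \<open>c\<close>, \<open>c'\<close>, \<open>d'\<close> follow each other on a geodesic.\<close>

lemma coord_fiber_wide:
  assumes V: "a \<in> V" "b \<in> V" "c \<in> V" "d \<in> V" "c' \<in> V" "d' \<in> V"
    and i: "\<rho> a b = i" "\<rho> c d = i" "\<rho> c' d' = i" "2 \<le> i"
    and eq: "line c d = line a b" "line c' d' = line a b"
    and p: "i \<le> p" "coord a b c = int p" "coord a b c' = int p"
      "coord a b d = int (p + i)" "coord a b d' = int (p + i)"
    and distinct: "(c, d) \<noteq> (c', d')"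
  shows "\<rho> d d' = 2 * i + \<rho> c c'"
proof -
  have ne: "a \<noteq> b" "c \<noteq> d" "c' \<noteq> d'"
    using V i dist_eq_0[of a b] dist_eq_0[of c d] dist_eq_0[of c' d'] by auto
  have L: "c \<in> line a b" "d \<in> line a b" "c' \<in> line a b" "d' \<in> line a b"
    using eq ends_in_line by metis+
  have A: "\<rho> a c = p" "\<rho> b c = p - i" "\<rho> a c' = p" "\<rho> b c' = p - i"
    "\<rho> a d = p + i" "\<rho> b d = p" "\<rho> a d' = p + i" "\<rho> b d' = p"
    using coord_int[OF V(1,2) ne(1) L(1) p(2)] coord_int[OF V(1,2) ne(1) L(2) p(4)]
      coord_int[OF V(1,2) ne(1) L(3) p(3)] coord_int[OF V(1,2) ne(1) L(4) p(5)] p(1) i by auto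
  have s: "\<rho> b a = \<rho> a b" "\<rho> c b = \<rho> b c" "\<rho> d b = \<rho> b d" "\<rho> c' b = \<rho> b c'" "\<rho> d' b = \<rho> b d'"
    "\<rho> d c' = \<rho> c' d" "\<rho> d' c = \<rho> c d'" "\<rho> c' c = \<rho> c c'" "\<rho> d' d = \<rho> d d'" "\<rho> b b = 0"
    using V dist_sym dist_eq_0 by auto
  have "\<rho> d c' = \<rho> c c' + i"
    using side_constant[of a b c d c' b i p] V i eq p A s by auto
  moreover have "\<rho> d' c = \<rho> c' c + i"
    using side_constant[of a b c' d' c b i p] V i eq p A s by auto
  moreover have "\<rho> c d' + \<rho> d d' = i \<or> \<rho> c d' = i + \<rho> d d' \<or> \<rho> d d' = i + \<rho> c d'"
    using in_same_line[of c d c' d'] V ne i eq by auto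
  moreover have "\<not> (\<rho> c c' = 0 \<and> \<rho> d d' = 0)"
    using distinct dist_eq_0 V by auto
  moreover have "\<not> (0 < \<rho> c c' \<and> \<rho> d d' = \<rho> c c' \<and> \<rho> c d' = i + \<rho> c c' \<and> \<rho> d c' = i + \<rho> c c')"
    using same_line_not_parallel[of c d d' c' i "\<rho> c c'"] V i eq line_commute[of c' d'] dist_sym[of c' d']
    by auto
  ultimately show ?thesis using s by linarith
qed

section \<open>Counting the generators of one line at a fixed distance\<close>

definition equidistant_gens :: "'a set \<Rightarrow> nat \<Rightarrow> ('a \<times> 'a) set \<Rightarrow> bool" where
  "equidistant_gens L i E \<longleftrightarrow> E \<subseteq> V \<times> V \<and> (\<forall>(c, d)\<in>E. \<rho> c d = i \<and> line c d = L)"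

text \<open>Beyond \<open>b\<close>, the distance of two far ends is \<open>2 * i\<close> plus that
  of the near ends; betweenness among far ends would cost an extra \<open>2 * i\<close> against the
  triangle inequality. \<open>K\<close> is abstract because two bounds are plugged in: one of order
  \<open>sqrt(2N)\<close> from general position, and 2 for pairs inside an antipodal configuration,
  from the separation \<open>2 * i\<close>.\<close>

lemma card_coord_fiber:
  assumes E: "equidistant_gens L i E" and i: "2 \<le> i" and ab: "(a, b) \<in> E" and K: "1 \<le> K"
    and wide: "\<And>S. S \<subseteq> snd ` E \<Longrightarrow> general_position S \<Longrightarrow>
      (\<forall>x\<in>S. \<forall>y\<in>S. x \<noteq> y \<longrightarrow> 2 * i \<le> \<rho> x y) \<Longrightarrow> card S \<le> K"
  shows "card {(c, d) \<in> E. coord a b c = int p \<and> coord a b d = int (p + i)} \<le> K"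
    (is "card ?F \<le> K")
proof -
  define F where "F = ?F"
  have el: "fst x \<in> V" "snd x \<in> V" "\<rho> (fst x) (snd x) = i" "line (fst x) (snd x) = L"
    "coord a b (fst x) = int p" "coord a b (snd x) = int (p + i)" if "x \<in> F" for x
    using that E unfolding equidistant_gens_def F_def by auto
  have ab': "a \<in> V" "b \<in> V" "\<rho> a b = i" "line a b = L"
    using ab E unfolding equidistant_gens_def by auto
  have "card F \<le> K"
  proof (cases "p < i")
    case True
    have "x = y" if "x \<in> F" "y \<in> F" for x y
      using coord_fiber_narrow[OF ab'(1,2) el(1,2)[OF that(1)] el(1,2)[OF that(2)] ab'(3)
          el(3)[OF that(1)] el(3)[OF that(2)] i _ _ True] el[OF that(1)] el[OF that(2)] ab'(4)
      by (simp add: prod_eq_iff)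
    moreover have "finite F"
    proof (rule finite_subset)
      show "F \<subseteq> V \<times> V" using E unfolding equidistant_gens_def F_def by auto
    qed (simp add: finite_V)
    ultimately have "card F \<le> 1" unfolding One_nat_def by (subst card_le_Suc0_iff_eq) blast+
    then show ?thesis using K by simp
  next
    case False
    have wide_dist: "\<rho> (snd x) (snd y) = 2 * i + \<rho> (fst x) (fst y)"
      if "x \<in> F" "y \<in> F" "x \<noteq> y" for x y
      using coord_fiber_wide[OF ab'(1,2) el(1,2)[OF that(1)] el(1,2)[OF that(2)] ab'(3)
          el(3)[OF that(1)] el(3)[OF that(2)] i, of p] el[OF that(1)] el[OF that(2)] ab'(4) False that(3)
      by (simp add: prod_eq_iff)
    note V = el(1,2)
    have inj: "inj_on snd F"
    proof (rule inj_onI)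
      fix x y assume xy: "x \<in> F" "y \<in> F" "snd x = snd y"
      then have "\<rho> (snd x) (snd y) = 0" using V dist_eq_0 by metis
      then show "x = y" using wide_dist[of x y] xy(1,2) i by (cases "x = y") auto
    qed
    have "general_position (snd ` F)"
      unfolding general_position_def
    proof (intro ballI impI notI)
      fix d1 d2 d3
      assume "d1 \<in> snd ` F" "d2 \<in> snd ` F" "d3 \<in> snd ` F"
      then obtain x1 x2 x3 where x: "x1 \<in> F" "x2 \<in> F" "x3 \<in> F"
        "d1 = snd x1" "d2 = snd x2" "d3 = snd x3"
        by blast
      assume ne: "d1 \<noteq> d2" "d2 \<noteq> d3" "d1 \<noteq> d3" and col: "\<rho> d1 d3 = \<rho> d1 d2 + \<rho> d2 d3"
      have "x1 \<noteq> x2" "x2 \<noteq> x3" "x1 \<noteq> x3" using ne x by auto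
      then have "2 * i + \<rho> (fst x1) (fst x3) =
          (2 * i + \<rho> (fst x1) (fst x2)) + (2 * i + \<rho> (fst x2) (fst x3))"
        using col x wide_dist[OF x(1,2)] wide_dist[OF x(2,3)] wide_dist[OF x(1,3)] by simp
      moreover have "\<rho> (fst x1) (fst x3) \<le> \<rho> (fst x1) (fst x2) + \<rho> (fst x2) (fst x3)"
        using dist_triangle V x(1-3) by blast
      ultimately show False using i by linarith
    qed
    moreover have "\<forall>x\<in>snd ` F. \<forall>y\<in>snd ` F. x \<noteq> y \<longrightarrow> 2 * i \<le> \<rho> x y"
    proof (intro ballI impI)
      fix d e assume "d \<in> snd ` F" "e \<in> snd ` F" "d \<noteq> e"
      then obtain x y where "x \<in> F" "y \<in> F" "d = snd x" "e = snd y" "x \<noteq> y" by blast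
      then show "2 * i \<le> \<rho> d e" using wide_dist[of x y] by simp
    qed
    moreover have "snd ` F \<subseteq> snd ` E" unfolding F_def by blast
    ultimately have "card (snd ` F) \<le> K" using wide by blast
    then show ?thesis using card_image[OF inj] by simp
  qed
  then show ?thesis by (simp add: F_def)
qed

lemma card_equidistant_gens:
  assumes E: "equidistant_gens L i E" and i: "2 \<le> i" and K: "1 \<le> K" and sym: "E\<inverse> = E"
    and ext: "\<And>a b. (a, b) \<in> E \<Longrightarrow> \<exists>z\<in>L. \<rho> a z + \<rho> b z \<noteq> i"
    and wide: "\<And>S. S \<subseteq> snd ` E \<Longrightarrow> general_position S \<Longrightarrow>
      (\<forall>x\<in>S. \<forall>y\<in>S. x \<noteq> y \<longrightarrow> 2 * i \<le> \<rho> x y) \<Longrightarrow> card S \<le> K"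
  shows "card E \<le> 2 * ((2 * (D - i) + 1) * K)"
proof (cases "E = {}")
  case False
  then obtain a b where ab: "(a, b) \<in> E" by auto
  have fin: "finite E"
    using E finite_V unfolding equidistant_gens_def by (meson finite_SigmaI finite_subset)
  have EV: "c \<in> V" "d \<in> V" "\<rho> c d = i" "line c d = L" "c \<noteq> d" if "(c, d) \<in> E" for c d
  proof -
    show "c \<in> V" "d \<in> V" "\<rho> c d = i" "line c d = L"
      using that E unfolding equidistant_gens_def by auto
    then show "c \<noteq> d" using i dist_eq_0[of c c] by auto
  qed
  note abV = EV[OF ab]
  have iD: "i \<le> D" using dist_le_diam abV by metis
  define J where "J = {- int (D - i) .. int (D - i)}"
  define F where "F p = {(c, d) \<in> E. coord a b c = p \<and> coord a b d = p + int i}" for p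
  have fiber: "card (F p) \<le> K" for p
  proof (cases "0 \<le> p")
    case True
    then show ?thesis
      using card_coord_fiber[OF E i ab K wide, of "nat p"] by (simp add: F_def)
  next
    case False
    have ba: "(b, a) \<in> E" using ab sym by auto
    \<comment> \<open>Exchanging \<open>a\<close> and \<open>b\<close> reflects a coordinate
      \<open>x\<close> to \<open>i - x\<close>, so the reversed pair \<open>(d, c)\<close> has its
      near end at the positive position \<open>- p\<close>.\<close>
    let ?F' = "{(c, d) \<in> E. coord b a c = int (nat (- p)) \<and> coord b a d = int (nat (- p) + i)}"
    have "F p \<subseteq> prod.swap ` ?F'"
    proof
      fix x assume x: "x \<in> F p"
      then obtain c d where cd: "x = (c, d)" "(c, d) \<in> E" "coord a b c = p"
        "coord a b d = p + int i" by (auto simp: F_def)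
      have dc: "(d, c) \<in> E" using cd(2) sym by auto
      have "c \<in> line a b" "d \<in> line a b"
        using EV[OF cd(2)] abV ends_in_line[of c d] ends_in_line[of d c] by auto
      then have "coord b a c = int i - p" "coord b a d = - p"
        using coord_swap[of a b c] coord_swap[of a b d] abV cd by auto
      then have "(d, c) \<in> ?F'" using dc False by auto
      then show "x \<in> prod.swap ` ?F'" using cd(1) by force
    qed
    moreover have "finite ?F'" using fin by (rule rev_finite_subset) auto
    ultimately have "card (F p) \<le> card ?F'"
      by (meson card_image_le card_mono finite_imageI le_trans)
    also have "\<dots> \<le> K"
      by (rule card_coord_fiber[OF E i ba K wide])
    finally show ?thesis .
  qed
  have level: "coord a b c \<in> J" if cd: "(c, d) \<in> E" "coord a b d = coord a b c + int i" for c d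
  proof -
    note V = EV[OF cd(1)]
    have "c \<in> line a b" "d \<in> line a b"
      using V abV ends_in_line[of c d] ends_in_line[of d c] by auto
    have "coord a b d \<le> int (\<rho> a d)" by (simp add: coord_def)
    moreover have "\<rho> a d \<le> D" "\<rho> b c \<le> D" using dist_le_diam abV V by auto
    moreover have "- int (D - i) \<le> coord a b c"
    proof (cases "\<rho> b c = \<rho> a b + \<rho> a c")
      case True
      then show ?thesis using \<open>\<rho> b c \<le> D\<close> abV by (simp add: coord_def)
    next
      case False
      then show ?thesis by (simp add: coord_def)
    qed
    ultimately show ?thesis using cd(2) iD by (simp add: J_def)
  qed
  define P where "P = {(c, d) \<in> E. coord a b d = coord a b c + int i}"
  have "P \<subseteq> (\<Union>p\<in>J. F p)" using level by (auto simp: P_def F_def)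
  moreover have "finite (F p)" for p using fin by (rule rev_finite_subset) (auto simp: F_def)
  ultimately have "card P \<le> card (\<Union>p\<in>J. F p)"
    by (intro card_mono) (auto simp: J_def)
  also have "\<dots> \<le> (\<Sum>p\<in>J. card (F p))" by (intro card_UN_le) (simp add: J_def)
  also have "\<dots> \<le> (\<Sum>p\<in>J. K)" by (intro sum_mono fiber)
  also have "\<dots> = (2 * (D - i) + 1) * K"
  proof -
    have "card J = nat (2 * int (D - i) + 1)" by (simp add: J_def)
    also have "\<dots> = 2 * (D - i) + 1" by linarith
    finally show ?thesis by simp
  qed
  finally have cardP: "card P \<le> (2 * (D - i) + 1) * K" .
  have "E \<subseteq> P \<union> P\<inverse>"
  proof
    fix x assume "x \<in> E"
    then obtain c d where cd: "x = (c, d)" "(c, d) \<in> E" by (cases x) auto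
    have dc: "(d, c) \<in> E" using cd sym by auto
    have eq: "line c d = line a b" using EV[OF cd(2)] abV by simp
    have "coord a b d = coord a b c + int i \<or> coord a b c = coord a b d + int i"
    proof (rule coord_diff)
      show "\<not> (c \<notin> {a, b} \<and> d \<notin> {a, b} \<and> \<rho> a c + \<rho> b c = i \<and> \<rho> a d + \<rho> b d = i)"
      proof
        assume *: "c \<notin> {a, b} \<and> d \<notin> {a, b} \<and> \<rho> a c + \<rho> b c = i \<and> \<rho> a d + \<rho> b d = i"
        obtain z where z: "z \<in> L" "\<rho> a z + \<rho> b z \<noteq> i" using ext[OF ab] by auto
        have "z \<in> line a b" using z(1) abV(4) by simp
        then show False
          using antipodal_not_extendable[OF abV(1,2) EV(1,2)[OF cd(2)] abV(3) EV(3)[OF cd(2)] eq]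
            * abV(5) z(2) by blast
      qed
    qed (fact abV(1) abV(2) EV(1)[OF cd(2)] EV(2)[OF cd(2)] abV(3) EV(3)[OF cd(2)] i eq)+
    then show "x \<in> P \<union> P\<inverse>" using cd dc by (auto simp: P_def)
  qed
  moreover have "finite P" using fin by (rule rev_finite_subset) (auto simp: P_def)
  ultimately have "card E \<le> card P + card (P\<inverse>)"
    by (meson card_Un_le card_mono finite_UnI finite_converse le_trans)
  then show ?thesis using cardP by (simp add: card_inverse)
qed simp

end

section \<open>Counting non-adjacent pairs\<close>

lemma sum_odd_rev: "1 \<le> D \<Longrightarrow> (\<Sum>i\<in>{2..D}. 2 * (D - i) + 1) = (D - 1)\<^sup>2" for D :: nat
proof -
  have "(\<Sum>i\<in>{2..Suc n}. 2 * (i - 2) + 1) = n\<^sup>2" for n :: nat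
    by (induction n) (auto simp: power2_eq_square)
  moreover have "(\<Sum>i\<in>{2..D}. 2 * (D - i) + 1) = (\<Sum>i\<in>{2..D}. 2 * (i - 2) + 1)"
    by (subst sum.atLeastAtMost_rev) (auto intro!: sum.cong)
  moreover assume "1 \<le> D"
  ultimately show ?thesis by (metis One_nat_def Suc_pred' diff_Suc_1 less_eq_Suc_le)
qed

context geodesic_metric begin

definition gens :: "'a set \<Rightarrow> ('a \<times> 'a) set" where
  "gens L = {(a, b) \<in> V \<times> V. 2 \<le> \<rho> a b \<and> line a b = L}"

text \<open>All antipodal pairs are of this kind by \<open>antipodal_not_extendable\<close>; the
  remaining generators are those meeting the hypothesis \<open>ext\<close> of
  \<open>card_equidistant_gens\<close>.\<close>

definition maximal_gens :: "'a set \<Rightarrow> ('a \<times> 'a) set" where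
  "maximal_gens L = {(a, b) \<in> gens L. \<forall>z\<in>L. \<rho> a z + \<rho> b z = \<rho> a b}"

lemma finite_gens: "finite (gens L)" "finite (maximal_gens L)"
  using finite_subset[of "gens L" "V \<times> V"] finite_subset[of "maximal_gens L" "V \<times> V"] finite_V
  by (auto simp: gens_def maximal_gens_def)

lemma gens_sym:
  assumes "(a, b) \<in> gens L"
  shows "(b, a) \<in> gens L" "\<rho> b a = \<rho> a b"
  using assms line_commute[of a b] dist_sym[of a b] by (auto simp: gens_def)

lemma maximal_gens_sym:
  assumes "(a, b) \<in> gens L"
  shows "(b, a) \<in> maximal_gens L \<longleftrightarrow> (a, b) \<in> maximal_gens L"
  using assms gens_sym[OF assms] by (simp add: maximal_gens_def add.commute)

text \<open>The numbers of positions for the lengths \<open>2, ..., D\<close> are the odd numbers up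
  to \<open>2 D - 3\<close>, with sum \<open>(D - 1)^2\<close>. The missing \<open>2 D - 1\<close>
  leaves room for the maximal generators.\<close>

lemma card_gens_diff_maximal:
  assumes "1 \<le> D" and K: "1 \<le> K"
    and gp: "\<And>S. S \<subseteq> V \<Longrightarrow> general_position S \<Longrightarrow> card S \<le> K"
  shows "card (gens L - maximal_gens L) \<le> 2 * (D - 1)\<^sup>2 * K"
proof -
  define E where "E i = {(a, b) \<in> gens L - maximal_gens L. \<rho> a b = i}" for i
  have "card (E i) \<le> 2 * ((2 * (D - i) + 1) * K)" if "2 \<le> i" for i
  proof (rule card_equidistant_gens)
    show "equidistant_gens L i (E i)" by (auto simp: equidistant_gens_def E_def gens_def)
    have "(b, a) \<in> E i" if "(a, b) \<in> E i" for a b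
      using that gens_sym[of a b L] maximal_gens_sym[of a b L] by (simp add: E_def)
    then show "(E i)\<inverse> = E i" by (auto simp: set_eq_iff)
    show "\<exists>z\<in>L. \<rho> a z + \<rho> b z \<noteq> i" if "(a, b) \<in> E i" for a b
      using that by (auto simp: E_def maximal_gens_def)
    show "card S \<le> K" if "S \<subseteq> snd ` E i" "general_position S" for S
      using that by (intro gp) (auto simp: E_def gens_def)
  qed (use that K in auto)
  moreover have "gens L - maximal_gens L \<subseteq> (\<Union>i\<in>{2..D}. E i)"
    using dist_le_diam by (auto simp: E_def gens_def)
  moreover have "finite (\<Union>i\<in>{2..D}. E i)"
    using finite_gens finite_subset[of "E _" "gens L"] by (auto simp: E_def)
  ultimately have "card (gens L - maximal_gens L) \<le> card (\<Union>i\<in>{2..D}. E i)"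
    by (intro card_mono)
  also have "\<dots> \<le> (\<Sum>i\<in>{2..D}. card (E i))" by (intro card_UN_le) simp
  also have "\<dots> \<le> (\<Sum>i\<in>{2..D}. 2 * ((2 * (D - i) + 1) * K))"
    using \<open>\<And>i. 2 \<le> i \<Longrightarrow> card (E i) \<le> 2 * ((2 * (D - i) + 1) * K)\<close> by (intro sum_mono) simp
  also have "\<dots> = 2 * ((\<Sum>i\<in>{2..D}. 2 * (D - i) + 1) * K)"
    by (simp add: sum_distrib_left sum_distrib_right)
  also have "\<dots> = 2 * (D - 1)\<^sup>2 * K" using sum_odd_rev[OF assms(1)] by simp
  finally show ?thesis .
qed

text \<open>Each pair lies in the interval of the other, so the four cross distances add up to twice
  \<open>\<rho> a b\<close> and also to twice \<open>\<rho> c d\<close>.\<close>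

lemma maximal_gensD:
  assumes "(a, b) \<in> maximal_gens L" "(c, d) \<in> maximal_gens L"
  shows "\<rho> a b = \<rho> c d" "\<rho> a c + \<rho> a d = \<rho> a b" "\<rho> a d = \<rho> b c" "\<rho> a c = \<rho> b d"
proof -
  have V: "a \<in> V" "b \<in> V" "c \<in> V" "d \<in> V"
    and L: "a \<in> L" "b \<in> L" "c \<in> L" "d \<in> L"
    using assms ends_in_line by (auto simp: maximal_gens_def gens_def)
  have s: "\<rho> c a = \<rho> a c" "\<rho> c b = \<rho> b c" "\<rho> d a = \<rho> a d" "\<rho> d b = \<rho> b d"
    using V dist_sym by auto
  have "\<rho> a c + \<rho> b c = \<rho> a b" "\<rho> a d + \<rho> b d = \<rho> a b" "\<rho> c a + \<rho> d a = \<rho> c d"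
    "\<rho> c b + \<rho> d b = \<rho> c d"
    using assms L by (auto simp: maximal_gens_def)
  then show "\<rho> a b = \<rho> c d" "\<rho> a c + \<rho> a d = \<rho> a b" "\<rho> a d = \<rho> b c" "\<rho> a c = \<rho> b d"
    using s by linarith+
qed

text \<open>The maximal generators of a line are antipodal pairs at a common distance \<open>i\<close>. Every point
  is at distance at least \<open>i/2\<close> from one end of each of them, and since the whole configuration has
  diameter \<open>i\<close>, the lines spanned by such pairs have small multiplicity.\<close>

lemma card_maximal_gens:
  assumes D: "3 \<le> D"
  shows "card (maximal_gens L) * (card (maximal_gens L) - 2) \<le> 8 * card lines * (D - 1)\<^sup>2"
proof (cases "maximal_gens L = {}")
  case False
  define G where "G = maximal_gens L"
  obtain i where i: "\<And>a b. (a, b) \<in> G \<Longrightarrow> \<rho> a b = i"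
    using False maximal_gensD(1) unfolding G_def by (metis surj_pair)
  have GV: "a \<in> V" "b \<in> V" if "(a, b) \<in> G" for a b
    using that by (auto simp: G_def maximal_gens_def gens_def)
  have i2: "2 \<le> i"
    using False i by (fastforce simp: G_def maximal_gens_def gens_def)
  have symG: "(b, a) \<in> G" if "(a, b) \<in> G" for a b
    using that maximal_gens_sym[of a b L] by (simp add: G_def maximal_gens_def)
  have funG: "c = b" if "(a, b) \<in> G" "(a, c) \<in> G" for a b c
    using maximal_gensD(4)[of a b L a c] that dist_eq_0[of b c] dist_eq_0[of a a] GV
    unfolding G_def by auto
  define S where "S = fst ` G"
  have finG: "finite G" using finite_gens by (simp add: G_def)
  have finS: "finite S" using finG by (simp add: S_def)
  have cardS: "card S = card G"
    unfolding S_def by (rule card_image) (use funG in \<open>auto intro!: inj_onI\<close>)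
  define m where "m x = (SOME y. (x, y) \<in> G)" for x
  have m: "(x, m x) \<in> G" if "x \<in> S" for x
    using that unfolding m_def S_def by (auto intro: someI)
  have mS: "m x \<in> S" "m (m x) = x" "x \<in> V" "m x \<noteq> x" "\<rho> x (m x) = i" if "x \<in> S" for x
  proof -
    show 1: "m x \<in> S" using symG[OF m[OF that]] unfolding S_def by force
    show "m (m x) = x" using funG symG[OF m[OF that]] m[OF 1] by blast
    show "x \<in> V" using GV m[OF that] by blast
    show "\<rho> x (m x) = i" using i m[OF that] by blast
    then show "m x \<noteq> x" using \<open>x \<in> V\<close> dist_eq_0[of x x] i2 by auto
  qed
  have sum1: "\<rho> e f + \<rho> e (m f) = i" if "e \<in> S" "f \<in> S" for e f
    using maximal_gensD(2)[of e "m e" L f "m f"] m[OF that(1)] m[OF that(2)] i unfolding G_def by auto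
  have sum2: "\<rho> (m e) f = \<rho> e (m f)" if "e \<in> S" "f \<in> S" for e f
    using maximal_gensD(3)[of e "m e" L f "m f"] m[OF that(1)] m[OF that(2)] unfolding G_def by auto
  have le_i: "\<rho> e f \<le> i" if "e \<in> S" "f \<in> S" for e f using sum1[OF that] by simp
  have mate_iff: "\<rho> e f = i \<longleftrightarrow> f = m e" if "e \<in> S" "f \<in> S" for e f
    using sum1[OF that] sum2[OF that] dist_eq_0[of "m e" f] mS(3)[OF mS(1)[OF that(1)]] mS(3)[OF that(2)]
    by auto
  define Q where "Q = {(e, f) \<in> S \<times> S. e \<noteq> f \<and> f \<noteq> m e \<and> i \<le> 2 * \<rho> e f}"
  have finQ: "finite Q" using finS finite_subset[of Q "S \<times> S"] by (auto simp: Q_def)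
  have "card S - 2 \<le> 2 * card {f. (e, f) \<in> Q}" if e: "e \<in> S" for e
  proof -
    let ?A = "{f. (e, f) \<in> Q}"
    have finA: "finite ?A" using finS by (rule rev_finite_subset) (auto simp: Q_def)
    have "S - {e, m e} \<subseteq> ?A \<union> m ` ?A"
    proof
      fix f assume f: "f \<in> S - {e, m e}"
      have "m f \<in> S" "m f \<noteq> e" "m f \<noteq> m e" "m (m f) = f" using f mS e by (metis Diff_iff insertCI)+
      then have "f \<in> ?A \<or> m f \<in> ?A" using f e sum1[of e f] by (auto simp: Q_def)
      then show "f \<in> ?A \<union> m ` ?A" using \<open>m (m f) = f\<close> by (metis UnI1 UnI2 image_eqI)
    qed
    then have "card (S - {e, m e}) \<le> card (?A \<union> m ` ?A)"
      using finA by (intro card_mono) auto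
    also have "\<dots> \<le> card ?A + card ?A"
      using card_Un_le[of ?A "m ` ?A"] card_image_le[OF finA, of m] by linarith
    finally show ?thesis
      using card_Diff_subset[of "{e, m e}" S] mS[OF e] e by simp
  qed
  then have "(\<Sum>e\<in>S. card S - 2) \<le> (\<Sum>e\<in>S. 2 * card {f. (e, f) \<in> Q})"
    by (intro sum_mono)
  also have "\<dots> = 2 * card (SIGMA e:S. {f. (e, f) \<in> Q})"
    using finS finite_subset[of "{f. (_, f) \<in> Q}" S]
    by (subst card_SigmaI) (auto simp: Q_def sum_distrib_left)
  also have "(SIGMA e:S. {f. (e, f) \<in> Q}) = Q" by (auto simp: Q_def)
  finally have lower: "card S * (card S - 2) \<le> 2 * card Q" by simp
  have "card Q \<le> 4 * card lines * (D - 1)\<^sup>2"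
  proof (cases "i = 2")
    \<comment> \<open>Here pairs in \<open>Q\<close> are adjacent and out of reach of
      \<open>card_equidistant_gens\<close>. But \<open>S\<close> is a cocktail-party graph, and the
      line of \<open>e\<close>, \<open>f\<close> meets it only in these points and their mates. The
      bound 16 fits under \<open>4 * (D - 1)^2\<close> because \<open>3 \<le> D\<close>.\<close>
    case True
    have one: "\<rho> e f = 1" if "e \<in> S" "f \<in> S" "f \<noteq> e" "f \<noteq> m e" for e f
    proof -
      have "e \<noteq> m f" using mS(2)[of f] that by auto
      then have "\<rho> e f \<noteq> 0" "\<rho> e (m f) \<noteq> 0"
        using dist_eq_0[of e f] dist_eq_0[of e "m f"] mS(1)[of f] mS(3) that by auto
      then show ?thesis using sum1[of e f] that True by simp
    qed
    have "card {x \<in> Q. line (fst x) (snd x) = M} \<le> 16" for M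
    proof (cases "{x \<in> Q. line (fst x) (snd x) = M} = {}")
      case False
      then obtain e f where ef: "(e, f) \<in> Q" "line e f = M" by auto
      have efS: "e \<in> S" "f \<in> S" "e \<noteq> f" "f \<noteq> m e" using ef by (auto simp: Q_def)
      have in4: "h \<in> {e, f, m e, m f}" if h: "h \<in> S" "h \<in> line e f" for h
      proof (rule ccontr)
        assume n: "h \<notin> {e, f, m e, m f}"
        then have "\<rho> e h = 1" "\<rho> f h = 1" "\<rho> e f = 1" "\<rho> h f = 1"
          using one[of e h] one[of f h] one[of e f] h efS dist_sym[of f h] mS by auto
        then show False using mem_line[of e f h] h efS mS by auto
      qed
      have "{x \<in> Q. line (fst x) (snd x) = M} \<subseteq> {e, f, m e, m f} \<times> {e, f, m e, m f}"
      proof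
        fix x assume "x \<in> {x \<in> Q. line (fst x) (snd x) = M}"
        then have "fst x \<in> S" "snd x \<in> S" "fst x \<in> line e f" "snd x \<in> line e f"
          using ef(2) ends_in_line[of "fst x" "snd x"] ends_in_line[of "snd x" "fst x"]
          by (auto simp: Q_def)
        then show "x \<in> {e, f, m e, m f} \<times> {e, f, m e, m f}" unfolding mem_Times_iff using in4 by blast
      qed
      then have "card {x \<in> Q. line (fst x) (snd x) = M}
          \<le> card ({e, f, m e, m f} \<times> {e, f, m e, m f})" by (intro card_mono) auto
      also have "\<dots> = card {e, f, m e, m f} * card {e, f, m e, m f}"
        by (rule card_cartesian_product)
      also have "\<dots> \<le> 4 * 4" by (intro mult_mono) (auto simp: card_insert_if)
      finally show ?thesis by simp
    next
      case True
      show ?thesis unfolding True by simp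
    qed
    then have "(\<Sum>M\<in>lines. card {x \<in> Q. line (fst x) (snd x) = M}) \<le> (\<Sum>M\<in>lines. 16)"
      by (intro sum_mono)
    moreover have "Q \<subseteq> (\<Union>M\<in>lines. {x \<in> Q. line (fst x) (snd x) = M})"
      using line_in_lines mS(3) by (auto simp: Q_def)
    then have "card Q \<le> (\<Sum>M\<in>lines. card {x \<in> Q. line (fst x) (snd x) = M})"
      using finQ finite_lines
      by (intro order.trans[OF card_mono card_UN_le]) auto
    ultimately have "card Q \<le> 4 * card lines * 2\<^sup>2" by simp
    also have "\<dots> \<le> 4 * card lines * (D - 1)\<^sup>2"
      using D by (intro mult_left_mono power_mono) auto
    finally show ?thesis .
  next
    case False
    define E where "E M s = {(e, f) \<in> Q. \<rho> e f = s \<and> line e f = M}" for M s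
    have symQ: "(f, e) \<in> Q \<and> \<rho> f e = \<rho> e f \<and> line f e = line e f" if "(e, f) \<in> Q" for e f
      using that mS[of e] mS[of f] dist_sym[of e f] line_commute[of e f] by (auto simp: Q_def)
    have E_card: "card (E M s) \<le> 2 * ((2 * (D - s) + 1) * 2)" if "2 \<le> s" for M s
    proof (cases "E M s = {}")
      case nonempty: False
      show ?thesis
      proof (rule card_equidistant_gens)
        show "equidistant_gens M s (E M s)"
          using mS(3) by (auto simp: equidistant_gens_def E_def Q_def)
        show "(E M s)\<inverse> = E M s" using symQ by (fastforce simp: E_def)
        \<comment> \<open>The mate of \<open>e\<close> is on the line but outside the interval,
          since \<open>f\<close> lies strictly between \<open>e\<close> and
          \<open>m e\<close>.\<close>
        show "\<exists>z\<in>M. \<rho> e z + \<rho> f z \<noteq> s" if ef: "(e, f) \<in> E M s" for e f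
        proof -
          have e: "e \<in> S" "f \<in> S" "e \<noteq> f" "f \<noteq> m e" "\<rho> e f = s" "line e f = M"
            using ef by (auto simp: E_def Q_def)
          have "\<rho> f (m e) + s = i" "\<rho> e (m e) = i" "\<rho> f e = s"
            using sum1[of f e] e mS[OF e(1)] mS(3)[OF e(2)] dist_sym[of e f] by auto
          moreover have "s \<noteq> i" using mate_iff e by auto
          moreover have "m e \<in> line e f"
            using mem_line[of e f "m e"] e mS calculation by auto
          ultimately show ?thesis using e(6) by (intro bexI[of _ "m e"]) auto
        qed
        \<comment> \<open>Points of \<open>T\<close> are pairwise at distance at least
          \<open>2 * s \<ge> i\<close>, the largest distance in \<open>S\<close>, so any two of them
          are mates.\<close>
        show "card T \<le> 2" if T: "T \<subseteq> snd ` E M s" "\<forall>x\<in>T. \<forall>y\<in>T. x \<noteq> y \<longrightarrow> 2 * s \<le> \<rho> x y" for T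
        proof (cases "T = {}")
          case False
          then obtain x where x: "x \<in> T" by auto
          have TS: "T \<subseteq> S" using T(1) by (auto simp: E_def Q_def)
          have half: "i \<le> 2 * s" using nonempty by (auto simp: E_def Q_def)
          have "T \<subseteq> {x, m x}"
          proof
            fix y assume y: "y \<in> T"
            show "y \<in> {x, m x}"
            proof (cases "y = x")
              case False
              then have "\<rho> x y = i" using T(2) x y half le_i[of x y] TS by fastforce
              then show ?thesis using mate_iff[of x y] TS x y by auto
            qed simp
          qed
          then have "card T \<le> card {x, m x}" by (intro card_mono) auto
          then show ?thesis by (simp add: card_insert_if split: if_splits)
        qed simp
      qed (use that in auto)
    qed simp
    have "Q \<subseteq> (\<Union>M\<in>lines. \<Union>s\<in>{2..D}. E M s)"
    proof
      fix x assume x: "x \<in> Q"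
      obtain e f where ef: "x = (e, f)" by (cases x)
      have "e \<in> V" "f \<in> V" "e \<noteq> f" "i \<le> 2 * \<rho> e f" using x ef mS(3) by (auto simp: Q_def)
      then have "line e f \<in> lines" "\<rho> e f \<in> {2..D}"
        using line_in_lines dist_le_diam i2 False by auto
      then show "x \<in> (\<Union>M\<in>lines. \<Union>s\<in>{2..D}. E M s)" using x ef by (auto simp: E_def)
    qed
    moreover have finE: "finite (E M s)" for M s
      using finQ by (rule rev_finite_subset) (auto simp: E_def)
    ultimately have "card Q \<le> card (\<Union>M\<in>lines. \<Union>s\<in>{2..D}. E M s)"
      using finite_lines by (intro card_mono) auto
    also have "\<dots> \<le> (\<Sum>M\<in>lines. card (\<Union>s\<in>{2..D}. E M s))"
      by (intro card_UN_le finite_lines)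
    also have "\<dots> \<le> (\<Sum>M\<in>lines. \<Sum>s\<in>{2..D}. card (E M s))"
      by (intro sum_mono card_UN_le) simp
    also have "\<dots> \<le> (\<Sum>M\<in>lines. \<Sum>s\<in>{2..D}. 2 * ((2 * (D - s) + 1) * 2))"
      by (intro sum_mono E_card) simp
    also have "(\<Sum>s\<in>{2..D}. 2 * ((2 * (D - s) + 1) * 2)) = 4 * (\<Sum>s\<in>{2..D}. 2 * (D - s) + 1)"
      unfolding sum_distrib_left by (intro sum.cong) auto
    also have "(\<Sum>s\<in>{2..D}. 2 * (D - s) + 1) = (D - 1)\<^sup>2" using D by (intro sum_odd_rev) simp
    finally show ?thesis by simp
  qed
  then have "card S * (card S - 2) \<le> 8 * card lines * (D - 1)\<^sup>2" using lower by linarith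
  then show ?thesis using cardS by (simp add: G_def)
qed simp

section \<open>Summation over all lines\<close>

lemma card_general_position:
  assumes "S \<subseteq> V" "general_position S"
  shows "real (card S) * (real (card S) - 1) \<le> 2 * real (card lines)"
proof -
  have "card S * (card S - 1) \<le> 2 * card lines"
  proof -
    have "2 * (card S choose 2) = card S * (card S - 1)"
      unfolding choose_two by (rule dvd_mult_div_cancel) (cases "card S"; simp)
    then show ?thesis using general_position_choose_two[OF assms] by linarith
  qed
  then have "real (card S * (card S - 1)) \<le> 2 * real (card lines)"
    by (metis of_nat_le_iff of_nat_mult of_nat_numeral)
  then show ?thesis by (cases "card S") (auto simp: algebra_simps)
qed

lemma card_nonadjacent_pairs:
  assumes D: "3 \<le> D"
  shows "real (card {(x, y) \<in> V \<times> V. 2 \<le> \<rho> x y})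
    \<le> 2 * (real D)\<^sup>2 * real (card lines) * (1 + sqrt (2 * real (card lines)))"
proof -
  define N where "N = real (card lines)"
  define r where "r = sqrt (2 * N)"
  have r: "0 \<le> r" "r\<^sup>2 = 2 * N" by (auto simp: r_def N_def)
  define K where "K = nat \<lfloor>1 + r\<rfloor>"
  have K: "real K \<le> 1 + r" "1 \<le> K" unfolding K_def using r(1) by linarith+
  have "card S \<le> K" if "S \<subseteq> V" "general_position S" for S
  proof -
    let ?m = "real (card S)"
    have "(?m - 1)\<^sup>2 \<le> r\<^sup>2" if "1 \<le> ?m"
      using card_general_position[OF \<open>S \<subseteq> V\<close> \<open>general_position S\<close>] that r(2)
      by (simp add: N_def power2_eq_square algebra_simps)
    then have "?m \<le> 1 + r" using r(1) power2_le_imp_le[of "?m - 1" r] by force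
    then show ?thesis unfolding K_def by linarith
  qed
  note ext = card_gens_diff_maximal[OF _ K(2) this]
  have "real (card (gens L)) \<le> 2 * (real D)\<^sup>2 * (1 + r)" for L
  proof -
    let ?g = "real (card (maximal_gens L))" and ?d = "real D - 1"
    have d: "2 \<le> ?d" using D by simp
    have "card (gens L) \<le> card (gens L - maximal_gens L) + card (maximal_gens L)"
      using card_Un_le[of "gens L - maximal_gens L" "maximal_gens L"]
      by (simp add: Un_Diff_cancel2 sup.absorb1 maximal_gens_def subset_iff)
    also have "\<dots> \<le> 2 * (D - 1)\<^sup>2 * K + card (maximal_gens L)"
      using ext[of L] D by simp
    finally have "real (card (gens L)) \<le> real (2 * (D - 1)\<^sup>2 * K + card (maximal_gens L))"
      by (simp only: of_nat_le_iff)
    also have "\<dots> = 2 * ?d\<^sup>2 * real K + ?g" using D by (simp add: of_nat_diff)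
    also have "\<dots> \<le> 2 * ?d\<^sup>2 * (1 + r) + ?g" using K by (simp add: mult_left_mono)
    also have "?g \<le> 2 * ?d * (1 + r)"
    proof (cases "?g \<le> 2")
      case True
      have "2 * 2 * 1 \<le> 2 * ?d * (1 + r)" using d r(1) by (intro mult_mono) auto
      then show ?thesis using True by simp
    next
      case False
      then have g: "2 < card (maximal_gens L)" by simp
      have "(?g - 2)\<^sup>2 \<le> ?g * (?g - 2)" using False by (simp add: power2_eq_square mult_right_mono)
      also have "\<dots> = real (card (maximal_gens L) * (card (maximal_gens L) - 2))"
        using g by (simp add: of_nat_diff)
      also have "\<dots> \<le> real (8 * card lines * (D - 1)\<^sup>2)"
        using card_maximal_gens[OF D, of L] by (simp only: of_nat_le_iff)
      also have "\<dots> = 4 * ?d\<^sup>2 * r\<^sup>2" using D r(2) by (simp add: of_nat_diff N_def)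
      also have "\<dots> = (2 * ?d * r)\<^sup>2" by (simp only: power_mult_distrib) simp
      finally have "?g - 2 \<le> 2 * ?d * r"
        using d r(1) by (intro power2_le_imp_le[of "?g - 2"]) auto
      then show ?thesis using d by (simp add: algebra_simps)
    qed
    \<comment> \<open>As \<open>(D - 1)^2 + (D - 1) \<le> D^2\<close>, the maximal generators are
      absorbed without loss in the leading constant.\<close>
    also have "2 * ?d\<^sup>2 * (1 + r) + 2 * ?d * (1 + r) = 2 * (?d * (?d + 1)) * (1 + r)"
      by (simp add: power2_eq_square algebra_simps)
    also have "\<dots> \<le> 2 * (real D)\<^sup>2 * (1 + r)"
      using d r(1) by (intro mult_right_mono mult_left_mono) (auto simp: power2_eq_square)
    finally show ?thesis by simp
  qed
  then have "(\<Sum>L\<in>lines. real (card (gens L))) \<le> (\<Sum>L\<in>lines. 2 * (real D)\<^sup>2 * (1 + r))"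
    by (intro sum_mono)
  also have "\<dots> = 2 * (real D)\<^sup>2 * N * (1 + r)" by (simp add: N_def)
  finally have le: "(\<Sum>L\<in>lines. real (card (gens L))) \<le> 2 * (real D)\<^sup>2 * N * (1 + r)" .
  have "{(x, y) \<in> V \<times> V. 2 \<le> \<rho> x y} \<subseteq> (\<Union>L\<in>lines. gens L)"
    using line_in_lines dist_eq_0 by (fastforce simp: gens_def)
  then have "card {(x, y) \<in> V \<times> V. 2 \<le> \<rho> x y} \<le> (\<Sum>L\<in>lines. card (gens L))"
    using finite_gens finite_lines by (intro order.trans[OF card_mono card_UN_le]) auto
  then have "real (card {(x, y) \<in> V \<times> V. 2 \<le> \<rho> x y}) \<le> (\<Sum>L\<in>lines. real (card (gens L)))"
    unfolding of_nat_sum[symmetric] by (simp only: of_nat_le_iff)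
  then show ?thesis using le by (simp add: N_def r_def)
qed

end

section \<open>Cliques among points at mutual distance at most two\<close>

text \<open>Layer-cake formula, applied below with the same thresholds to a height of lines and to
  the degrees of vertices.\<close>

lemma sum_eq_sum_card_less:
  fixes f :: "'b \<Rightarrow> nat"
  assumes "finite A" "\<And>x. x \<in> A \<Longrightarrow> f x \<le> n"
  shows "(\<Sum>x\<in>A. f x) = (\<Sum>j<n. card {x \<in> A. j < f x})"
proof -
  have "(\<Sum>x\<in>A. f x) = (\<Sum>x\<in>A. \<Sum>j<n. of_bool (j < f x))"
  proof (intro sum.cong refl)
    fix x assume "x \<in> A"
    then have "{..<n} \<inter> {j. j < f x} = {..<f x}" using assms(2) by fastforce
    then show "f x = (\<Sum>j<n. of_bool (j < f x))" by simp
  qed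
  also have "\<dots> = (\<Sum>j<n. \<Sum>x\<in>A. of_bool (j < f x))" by (rule sum.swap)
  also have "\<dots> = (\<Sum>j<n. card {x \<in> A. j < f x})"
    using assms(1) by (simp add: Int_def)
  finally show ?thesis .
qed

text \<open>Metric and lines remain those of \<open>V\<close>: a pair in \<open>U\<close> at
  distance 2 may have all its midpoints outside \<open>U\<close>.\<close>

locale diameter_two_subset = geodesic_metric +
  fixes U :: "'a set"
  assumes U_subset: "U \<subseteq> V"
    and dist_le_2: "x \<in> U \<Longrightarrow> y \<in> U \<Longrightarrow> \<rho> x y \<le> 2"
begin

definition pairs2 :: "'a set \<Rightarrow> ('a \<times> 'a) set" where
  "pairs2 S = {(x, y) \<in> S \<times> S. \<rho> x y = 2}"

definition class2 :: "'a set \<Rightarrow> 'a set \<Rightarrow> ('a \<times> 'a) set" where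
  "class2 S L = {(x, y) \<in> pairs2 S. line x y = L}"

definition lines2 :: "'a set \<Rightarrow> 'a set set" where
  "lines2 S = (\<lambda>(x, y). line x y) ` pairs2 S"

definition deg2 :: "'a set \<Rightarrow> 'a \<Rightarrow> nat" where
  "deg2 S x = card {y \<in> S. \<rho> x y = 2}"

text \<open>Distances in \<open>U\<close> are at most 2, so for subsets of \<open>U\<close> this is
  pairwise adjacency.\<close>

definition clique :: "'a set \<Rightarrow> bool" where
  "clique T \<longleftrightarrow> (\<forall>x\<in>T. \<forall>y\<in>T. \<rho> x y \<noteq> 2)"

lemma finite_U: "finite U"
  using U_subset finite_V by (rule finite_subset)

lemma finite_pairs2: "S \<subseteq> U \<Longrightarrow> finite (pairs2 S)"
  using finite_subset[of "pairs2 S" "U \<times> U"] finite_U by (auto simp: pairs2_def)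

lemma finite_lines2: "S \<subseteq> U \<Longrightarrow> finite (lines2 S)"
  using finite_pairs2 by (simp add: lines2_def)

lemma lines2_mono: "S \<subseteq> T \<Longrightarrow> lines2 S \<subseteq> lines2 T"
  by (auto simp: lines2_def pairs2_def)

lemma lines2_subset: "S \<subseteq> U \<Longrightarrow> lines2 S \<subseteq> lines"
proof
  fix L assume "S \<subseteq> U" "L \<in> lines2 S"
  then obtain x y where xy: "x \<in> V" "y \<in> V" "\<rho> x y = 2" "L = line x y"
    using U_subset by (auto simp: lines2_def pairs2_def)
  then have "x \<noteq> y" using dist_eq_0[of x x] by auto
  then show "L \<in> lines" using xy line_in_lines by simp
qed

lemma mem_line2:
  assumes "x \<in> U" "y \<in> U" "z \<in> U" "\<rho> x y = 2"
  shows "z \<in> line x y \<longleftrightarrow> z = x \<or> z = y \<or> \<rho> x z = 1 \<and> \<rho> y z = 1"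
proof -
  have V: "x \<in> V" "y \<in> V" "z \<in> V" using assms U_subset by auto
  have ne: "x \<noteq> y" using assms(4) V dist_eq_0[of x x] by auto
  have 1: "z \<in> line x y \<longleftrightarrow> \<rho> x z + \<rho> y z = 2 \<or> \<rho> x z = 2 + \<rho> y z \<or> \<rho> y z = 2 + \<rho> x z"
    using mem_line[OF V(1,2) ne V(3)] dist_sym[of z y] V assms(4) by simp
  have 2: "\<rho> x z \<le> 2" "\<rho> y z \<le> 2" using dist_le_2 assms by auto
  have 3: "\<rho> x z = 0 \<longleftrightarrow> z = x" "\<rho> y z = 0 \<longleftrightarrow> z = y" using dist_eq_0 V by auto
  have 4: "z = y \<Longrightarrow> \<rho> x z = 2" "z = x \<Longrightarrow> \<rho> y z = 2" using assms(4) dist_sym[of x y] V by auto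
  show ?thesis using 1 2 3 4 by linarith
qed

lemma pairs2_sym: "S \<subseteq> U \<Longrightarrow> (x, y) \<in> pairs2 S \<Longrightarrow> (y, x) \<in> pairs2 S"
  using dist_sym[of x y] U_subset by (auto simp: pairs2_def)

lemma class2_sym: "S \<subseteq> U \<Longrightarrow> (x, y) \<in> class2 S L \<Longrightarrow> (y, x) \<in> class2 S L"
  using pairs2_sym[of S x y] line_commute[of x y] U_subset by (auto simp: class2_def pairs2_def)

text \<open>Together with \<open>class2_functional\<close> this makes the endpoints of a class a
  cocktail-party graph: its pairs are a perfect matching of non-edges, everything else is
  adjacent.\<close>

lemma class2_dist:
  assumes "S \<subseteq> U" "(x, y) \<in> class2 S L" "(a, b) \<in> class2 S L" "a \<noteq> x" "a \<noteq> y"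
  shows "\<rho> x a = 1"
  using mem_line2[of x y a] ends_in_line(1)[of a b] assms by (auto simp: class2_def pairs2_def)

lemma class2_functional:
  assumes "S \<subseteq> U" "(x, y) \<in> class2 S L" "(x, z) \<in> class2 S L"
  shows "y = z"
proof -
  have "x \<in> U" "y \<in> U" "z \<in> U" "\<rho> x y = 2" "\<rho> x z = 2" "z \<in> line x y"
    using assms ends_in_line(2)[of z x] by (auto simp: class2_def pairs2_def)
  moreover have "\<rho> x x = 0" using dist_eq_0 \<open>x \<in> U\<close> U_subset by blast
  ultimately show ?thesis using mem_line2[of x y z] by auto
qed

lemma card_fst_class2: "S \<subseteq> U \<Longrightarrow> card (fst ` class2 S L) = card (class2 S L)"
  by (intro card_image inj_onI) (metis class2_functional prod.collapse)

lemma finite_class2: "S \<subseteq> U \<Longrightarrow> finite (class2 S L)"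
  using finite_subset[of "class2 S L" "pairs2 S"] finite_pairs2 by (auto simp: class2_def)

text \<open>An inclusion-maximal clique of a cocktail-party graph meets every non-edge. Since
  \<open>class2\<close> consists of ordered pairs, its cardinality is the number of endpoints, and
  the clique contains half of them.\<close>

lemma half_transversal:
  assumes S: "S \<subseteq> U"
  obtains A where "A \<subseteq> fst ` class2 S L" "clique A" "card (class2 S L) \<le> 2 * card A"
proof -
  let ?F = "fst ` class2 S L"
  have finF: "finite ?F" using finite_class2[OF S] by simp
  have FS: "?F \<subseteq> S" by (auto simp: class2_def pairs2_def)
  define X where "X = {A. A \<subseteq> ?F \<and> clique A}"
  have "finite X" "{} \<in> X" using finF by (simp_all add: X_def clique_def)
  then obtain A where "A \<in> X" "\<forall>B\<in>X. A \<subseteq> B \<longrightarrow> A = B"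
    using finite_has_maximal[of X] by (metis empty_iff)
  then have A: "A \<subseteq> ?F" "clique A"
    and max: "\<And>B. B \<subseteq> ?F \<Longrightarrow> clique B \<Longrightarrow> A \<subseteq> B \<Longrightarrow> A = B"
    unfolding X_def by blast+
  define m where "m x = (THE y. (x, y) \<in> class2 S L)" for x
  have m: "m x = y" if "(x, y) \<in> class2 S L" for x y
    unfolding m_def
  proof (rule the_equality)
    show "z = y" if "(x, z) \<in> class2 S L" for z
      by (rule class2_functional[OF S that]) fact
  qed fact
  have "?F \<subseteq> A \<union> m ` A"
  proof
    fix x assume x: "x \<in> ?F"
    show "x \<in> A \<union> m ` A"
    proof (rule ccontr)
      assume n: "x \<notin> A \<union> m ` A"
      have "\<not> clique (insert x A)" using max[of "insert x A"] A(1) x n by blast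
      moreover have "\<rho> x x = 0" using x FS S U_subset dist_eq_0[of x x] by auto
      moreover have "\<rho> y x = \<rho> x y" if "y \<in> A" for y
        using that x A(1) FS S U_subset by (intro dist_sym) auto
      ultimately obtain y where y: "y \<in> A" "\<rho> y x = 2"
        using A(2) by (auto simp: clique_def)
      obtain x' y' where xy: "(x, x') \<in> class2 S L" "(y, y') \<in> class2 S L"
        using x y A(1) by auto
      have "x = y \<or> x = y'" using class2_dist[OF S xy(2,1)] y(2) by auto
      then show False using m[OF xy(2)] y(1) n by auto
    qed
  qed
  moreover have "finite A" using A(1) finF by (rule finite_subset)
  ultimately have "card ?F \<le> card (A \<union> m ` A)" by (intro card_mono) auto
  also have "\<dots> \<le> card A + card A"
    using card_Un_le[of A "m ` A"] card_image_le[OF \<open>finite A\<close>, of m] by linarith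
  finally show ?thesis using that A card_fst_class2[OF S, of L] by simp
qed

text \<open>Such a \<open>z\<close> is a common neighbour of \<open>a\<close> and \<open>b\<close>,
  hence on the line shared by the whole class, and therefore a common neighbour of every other pair
  as well.\<close>

lemma class2_outside:
  assumes S: "S \<subseteq> U" and ab: "(a, b) \<in> class2 S L"
    and z: "z \<in> S" "z \<notin> fst ` class2 S L" "\<rho> a z \<noteq> 2" "\<rho> b z \<noteq> 2"
    and x: "x \<in> fst ` class2 S L"
  shows "\<rho> x z \<noteq> 2"
proof -
  obtain y where xy: "(x, y) \<in> class2 S L" using x by auto
  have ba: "(b, a) \<in> class2 S L" and yx: "(y, x) \<in> class2 S L"
    using class2_sym[OF S] ab xy by auto
  have ne: "z \<noteq> a" "z \<noteq> b" "z \<noteq> x" "z \<noteq> y" using z(2) ab ba xy yx by force+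
  have in_U: "a \<in> U" "b \<in> U" "x \<in> U" "y \<in> U" "z \<in> U"
    and l: "\<rho> a b = 2" "\<rho> x y = 2" "line x y = line a b"
    using S ab xy z(1) by (auto simp: class2_def pairs2_def)
  have "\<rho> a z \<noteq> 0" "\<rho> b z \<noteq> 0" using in_U U_subset dist_eq_0 ne by (metis subsetD)+
  then have "\<rho> a z = 1" "\<rho> b z = 1"
    using z(3,4) dist_le_2[of a z] dist_le_2[of b z] in_U by auto
  then have "z \<in> line x y" using mem_line2[of a b z] in_U l by simp
  then show ?thesis using mem_line2[of x y z] in_U l ne by auto
qed

lemma sum_deg2:
  assumes "S \<subseteq> U"
  shows "(\<Sum>x\<in>S. deg2 S x) = (\<Sum>L\<in>lines2 S. card (class2 S L))"
proof -
  have fin: "finite S" using assms finite_U by (rule finite_subset)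
  have "(\<Sum>x\<in>S. deg2 S x) = card (SIGMA x:S. {y \<in> S. \<rho> x y = 2})"
    using fin by (simp add: deg2_def)
  also have "(SIGMA x:S. {y \<in> S. \<rho> x y = 2}) = (\<Union>L\<in>lines2 S. class2 S L)"
    by (auto simp: lines2_def class2_def pairs2_def)
  also have "card \<dots> = (\<Sum>L\<in>lines2 S. card (class2 S L))"
    using assms finite_lines2 finite_class2
    by (intro card_UN_disjoint) (auto simp: class2_def)
  finally show ?thesis .
qed

text \<open>Take for \<open>Z\<close> the class and everything at distance 2 from \<open>a\<close>
  or \<open>b\<close>. After deleting \<open>Z\<close>, any clique in the rest can be enlarged by
  \<open>A\<close>, that is, by half of the class.\<close>

lemma bite:
  assumes S: "S \<subseteq> U" and L: "L \<in> lines2 S"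
    and small: "(a, b) \<in> class2 S L" "deg2 S a \<le> h" "deg2 S b \<le> h"
  obtains A Z where "A \<subseteq> Z" "Z \<subseteq> S" "Z \<noteq> {}" "clique A" "card (class2 S L) \<le> 2 * card A"
    "card Z \<le> 2 * h + card (class2 S L)" "\<And>x z. x \<in> A \<Longrightarrow> z \<in> S - Z \<Longrightarrow> \<rho> x z \<noteq> 2"
proof -
  obtain A where A: "A \<subseteq> fst ` class2 S L" "clique A" "card (class2 S L) \<le> 2 * card A"
    by (rule half_transversal[OF S])
  define Z where "Z = ({y \<in> S. \<rho> a y = 2} \<union> {y \<in> S. \<rho> b y = 2}) \<union> fst ` class2 S L"
  have "card Z \<le> (deg2 S a + deg2 S b) + card (class2 S L)"
    unfolding Z_def deg2_def card_fst_class2[OF S, of L, symmetric]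
    by (intro order.trans[OF card_Un_le] add_mono card_Un_le order.refl)
  moreover have "fst ` class2 S L \<subseteq> S" by (auto simp: class2_def pairs2_def)
  moreover have "a \<in> Z" using small(1) by (force simp: Z_def)
  moreover have "\<rho> x z \<noteq> 2" if "x \<in> A" "z \<in> S - Z" for x z
    using class2_outside[OF S small(1), of z x] that A(1) by (auto simp: Z_def)
  moreover have "A \<subseteq> Z" "Z \<subseteq> S" using A(1) calculation(2) by (auto simp: Z_def)
  ultimately show ?thesis using that[of A Z] A(2,3) small(2,3) by fastforce
qed

text \<open>A minimal counterexample \<open>S\<close> loses few lines when any \<open>Q\<close> is deleted from it. Applied to the
  vertices of large degree, this shows that the typical line has a generating pair of small degree;
  a transversal of its class is then adjacent to all but few points of \<open>S\<close>.\<close>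

lemma large_clique:
  fixes M :: real
  assumes "S \<subseteq> U" "4 * real (card S) \<le> M" "0 < M"
  shows "\<exists>T\<subseteq>S. clique T \<and> (real (card S))\<^sup>2 \<le> 17 * (real (card (lines2 S)) + M) * real (card T)"
  using assms(1,2)
proof (induction "card S" arbitrary: S rule: less_induct)
  case less
  note S = less.prems(1)
  have finS: "finite S" using S finite_U by (rule finite_subset)
  define s where "s = real (card S)"
  define C where "C X = real (card (lines2 X)) + M" for X
  have Cpos: "0 < C X" for X using assms(3) by (simp add: C_def)
  have C_mono: "C X \<le> C S" if "X \<subseteq> S" for X
    unfolding C_def using lines2_mono[OF that] finite_lines2[OF S] by (simp add: card_mono)
  have sC: "4 * s \<le> C S" using less.prems(2) by (simp add: s_def C_def)
  show ?case
  proof (rule ccontr)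
    assume "\<not> ?case"
    then have no: "17 * C S * real (card T) < s\<^sup>2" if "T \<subseteq> S" "clique T" for T
      using that by (force simp: C_def s_def not_le)
    have spos: "0 < s" using no[of "{}"] by (cases "s = 0") (auto simp: clique_def s_def)
    have IH: "\<exists>T\<subseteq>S - Q. clique T \<and> (s - real (card Q))\<^sup>2 \<le> 17 * C (S - Q) * real (card T)"
      if Q: "Q \<subseteq> S" "Q \<noteq> {}" for Q
    proof -
      have finQ: "finite Q" using Q(1) finS by (rule finite_subset)
      have "card (S - Q) = card S - card Q" "card Q \<le> card S" "card Q \<noteq> 0"
        using Q finQ finS by (auto simp: card_Diff_subset card_mono)
      then have "card (S - Q) < card S" "real (card (S - Q)) = s - real (card Q)"
        by (auto simp: s_def)
      moreover have "S - Q \<subseteq> U" "4 * real (card (S - Q)) \<le> M"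
        using S less.prems(2) calculation(1) by auto
      ultimately show ?thesis using less.hyps[of "S - Q"] by (simp add: C_def)
    qed
    \<comment> \<open>The induction hypothesis for \<open>S - Q\<close> against the failure for
      \<open>S\<close> yields \<open>C (S - Q) \<ge> C S * (1 - q/s)^2\<close>, with
      \<open>q\<close> the size of \<open>Q\<close>; the square is weakened to
      \<open>1 - 2 * q/s\<close>.\<close>
    have killed: "s * (C S - C (S - Q)) \<le> 2 * C S * real (card Q)" if Q: "Q \<subseteq> S" for Q
    proof (cases "Q = {}")
      case False
      let ?q = "real (card Q)"
      obtain T where T: "T \<subseteq> S - Q" "clique T" "(s - ?q)\<^sup>2 \<le> 17 * C (S - Q) * real (card T)"
        using IH[OF Q False] by blast
      have "(s - ?q)\<^sup>2 * C S \<le> (17 * C (S - Q) * real (card T)) * C S"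
        using T(3) Cpos[of S] by (intro mult_right_mono) auto
      also have "\<dots> = C (S - Q) * (17 * C S * real (card T))" by simp
      also have "\<dots> \<le> C (S - Q) * s\<^sup>2"
        using no[of T] T(1,2) Cpos[of "S - Q"] by (intro mult_left_mono less_imp_le) auto
      finally have "s * (s * (C S - C (S - Q))) \<le> s * (2 * C S * ?q) - C S * ?q\<^sup>2"
        by (simp add: power2_eq_square algebra_simps)
      also have "\<dots> \<le> s * (2 * C S * ?q)" using Cpos[of S] by simp
      finally show ?thesis using spos by simp
    qed simp
    \<comment> \<open>Deleting all vertices of degree above some \<open>j < h L\<close> destroys
      every generating pair of \<open>L\<close> at distance 2, so \<open>killed\<close> limits the
      number of lines with large \<open>h\<close>.\<close>
    define h where "h L = (LEAST h. \<exists>(a, b)\<in>class2 S L. deg2 S a \<le> h \<and> deg2 S b \<le> h)" for L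
    have h: "\<exists>(a, b)\<in>class2 S L. deg2 S a \<le> h L \<and> deg2 S b \<le> h L"
      and h_le: "h L \<le> card S" if "L \<in> lines2 S" for L
    proof -
      have deg: "deg2 S a \<le> card S" for a
        unfolding deg2_def using finS by (intro card_mono) auto
      have "class2 S L \<noteq> {}" using that by (auto simp: lines2_def class2_def)
      then have ex: "\<exists>(a, b)\<in>class2 S L. deg2 S a \<le> card S \<and> deg2 S b \<le> card S"
        using deg by auto
      show "\<exists>(a, b)\<in>class2 S L. deg2 S a \<le> h L \<and> deg2 S b \<le> h L"
        unfolding h_def by (rule LeastI_ex) (use ex in blast)
      show "h L \<le> card S" unfolding h_def by (rule Least_le) (rule ex)
    qed
    define Q where "Q j = {v \<in> S. j < deg2 S v}" for j
    have layer: "s * real (card {L \<in> lines2 S. j < h L}) \<le> 2 * C S * real (card (Q j))" for j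
    proof -
      have "{L \<in> lines2 S. j < h L} \<subseteq> lines2 S - lines2 (S - Q j)"
      proof
        fix L assume L: "L \<in> {L \<in> lines2 S. j < h L}"
        have "L \<notin> lines2 (S - Q j)"
        proof
          assume "L \<in> lines2 (S - Q j)"
          then obtain a b where ab: "(a, b) \<in> pairs2 (S - Q j)" "line a b = L"
            by (auto simp: lines2_def)
          then have "(a, b) \<in> class2 S L" "deg2 S a \<le> j" "deg2 S b \<le> j"
            by (auto simp: class2_def pairs2_def Q_def)
          then have "h L \<le> j" unfolding h_def by (intro Least_le) auto
          then show False using L by simp
        qed
        then show "L \<in> lines2 S - lines2 (S - Q j)" using L by simp
      qed
      then have "card {L \<in> lines2 S. j < h L} \<le> card (lines2 S - lines2 (S - Q j))"
        using finite_lines2[OF S] by (intro card_mono) auto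
      also have "\<dots> = card (lines2 S) - card (lines2 (S - Q j))"
        using finite_lines2[OF S] lines2_mono[of "S - Q j" S]
        by (intro card_Diff_subset) (auto intro: finite_subset)
      finally have "real (card {L \<in> lines2 S. j < h L}) \<le> C S - C (S - Q j)"
        using card_mono[OF finite_lines2[OF S] lines2_mono[of "S - Q j" S]] by (simp add: C_def)
      then have "s * real (card {L \<in> lines2 S. j < h L}) \<le> s * (C S - C (S - Q j))"
        using spos by (intro mult_left_mono) auto
      also have "\<dots> \<le> 2 * C S * real (card (Q j))" by (rule killed) (auto simp: Q_def)
      finally show ?thesis .
    qed
    \<comment> \<open>Summed over all thresholds, \<open>layer\<close> compares the total height of
      the lines with the total degree, which is the total class size. Hence some line has
      \<open>h L\<close> small relative to its own class.\<close>
    have "s * real (\<Sum>L\<in>lines2 S. h L) = (\<Sum>j<card S. s * real (card {L \<in> lines2 S. j < h L}))"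
      using sum_eq_sum_card_less[of "lines2 S" h "card S"] finite_lines2[OF S] h_le
      by (simp add: sum_distrib_left)
    also have "\<dots> \<le> (\<Sum>j<card S. 2 * C S * real (card (Q j)))" by (intro sum_mono layer)
    also have "\<dots> = 2 * C S * real (\<Sum>v\<in>S. deg2 S v)"
      using sum_eq_sum_card_less[of S "deg2 S" "card S"] finS
      by (simp add: sum_distrib_left Q_def deg2_def card_mono)
    finally have total: "(\<Sum>L\<in>lines2 S. s * real (h L)) \<le>
        (\<Sum>L\<in>lines2 S. 2 * C S * real (card (class2 S L)))"
      using sum_deg2[OF S] by (simp add: sum_distrib_left)
    have "lines2 S \<noteq> {}"
    proof
      assume "lines2 S = {}"
      then have "clique S" by (auto simp: clique_def lines2_def pairs2_def)
      then have "17 * C S * s < s * s" using no[of S] by (simp add: s_def power2_eq_square)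
      then show False using sC spos by simp
    qed
    then obtain L where L: "L \<in> lines2 S" "s * real (h L) \<le> 2 * C S * real (card (class2 S L))"
      using total finite_lines2[OF S] by (meson sum_strict_mono not_le)
    let ?w = "real (card (class2 S L))"
    obtain a b where ab: "(a, b) \<in> class2 S L" "deg2 S a \<le> h L" "deg2 S b \<le> h L"
      using h[OF L(1)] by blast
    obtain A Z where AZ: "A \<subseteq> Z" "Z \<subseteq> S" "Z \<noteq> {}" "clique A" "card (class2 S L) \<le> 2 * card A"
      "card Z \<le> 2 * h L + card (class2 S L)"
      and join: "\<And>x z. x \<in> A \<Longrightarrow> z \<in> S - Z \<Longrightarrow> \<rho> x z \<noteq> 2"
      by (rule bite[OF S L(1) ab]) blast
    obtain T where T: "T \<subseteq> S - Z" "clique T"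
      "(s - real (card Z))\<^sup>2 \<le> 17 * C (S - Z) * real (card T)"
      using IH[OF AZ(2,3)] by blast
    let ?z = "real (card Z)"
    have join': "\<rho> x z \<noteq> 2" "\<rho> z x \<noteq> 2" if "x \<in> A" "z \<in> T" for x z
    proof -
      show "\<rho> x z \<noteq> 2" using join that T(1) by blast
      moreover have "\<rho> z x = \<rho> x z"
        by (rule dist_sym) (use that AZ(1,2) T(1) S U_subset in blast)+
      ultimately show "\<rho> z x \<noteq> 2" by simp
    qed
    have "clique (A \<union> T)"
      using AZ(4) T(2) join' unfolding clique_def by blast
    moreover have "A \<union> T \<subseteq> S" using AZ(1,2) T(1) by auto
    ultimately have lt: "17 * C S * real (card (A \<union> T)) < s\<^sup>2" using no by blast
    have fin: "finite A" "finite T" using AZ(1,2) T(1) finS by (auto intro: finite_subset[OF _ finS])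
    have "A \<inter> T = {}" using AZ(1) T(1) by auto
    then have "real (card (A \<union> T)) = real (card A) + real (card T)"
      using fin by (simp add: card_Un_disjoint)
    moreover have "17 * C S * (?w / 2) \<le> 17 * C S * real (card A)"
      using AZ(5) Cpos[of S] by (intro mult_left_mono) auto
    moreover have "17 * C (S - Z) * real (card T) \<le> 17 * C S * real (card T)"
      using C_mono[of "S - Z"] by (intro mult_right_mono) auto
    ultimately have "17 * C S * (?w / 2) + (s - ?z)\<^sup>2 < s\<^sup>2"
      using lt T(3) by (simp add: algebra_simps)
    then have 1: "17 * C S * (?w / 2) < 2 * (s * ?z)"
      using zero_le_power2[of ?z] power2_diff[of s ?z] by linarith
    \<comment> \<open>This estimate fixes 17: the degrees contribute 4 and the class itself 1/4, by
      \<open>4 * s \<le> C S\<close>, and twice the sum is 17/2.\<close>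
    have "s * ?z \<le> s * (2 * real (h L) + ?w)"
      using AZ(6) spos by (intro mult_left_mono) auto
    also have "\<dots> = 2 * (s * real (h L)) + s * ?w" by (simp add: algebra_simps)
    also have "\<dots> \<le> 2 * (2 * C S * ?w) + (C S / 4) * ?w"
      using L(2) sC by (intro add_mono mult_left_mono mult_right_mono) auto
    finally show False using 1 by simp
  qed
qed

end

section \<open>Lines forced by large cliques\<close>

context geodesic_metric begin

lemma clique_general_position:
  assumes "T \<subseteq> V" "\<And>x y. x \<in> T \<Longrightarrow> y \<in> T \<Longrightarrow> \<rho> x y \<le> 1"
  shows "general_position T"
  unfolding general_position_def
proof (intro ballI impI notI)
  fix x y z assume T: "x \<in> T" "y \<in> T" "z \<in> T" and ne: "x \<noteq> y" "y \<noteq> z"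
    and eq: "\<rho> x z = \<rho> x y + \<rho> y z"
  have "\<rho> x y \<noteq> 0" "\<rho> y z \<noteq> 0" using T ne assms(1) dist_eq_0 by (metis subsetD)+
  then show False using assms(2)[OF T(1,3)] eq by simp
qed

text \<open>\<open>\<tau>\<close> is the size of a clique. The term
  \<open>4 * real (card V)\<close>, required by \<open>large_clique\<close>, is of lower order than
  the \<open>n^(4/3)\<close> lines aimed at.\<close>

lemma diameter_two_bound:
  assumes U: "U \<subseteq> V" "\<And>x y. x \<in> U \<Longrightarrow> y \<in> U \<Longrightarrow> \<rho> x y \<le> 2" and "V \<noteq> {}"
  shows "\<exists>\<tau>. (real (card U))\<^sup>2 \<le> 17 * (real (card lines) + 4 * real (card V)) * \<tau> \<and>
    \<tau> * (\<tau> - 1) \<le> 2 * real (card lines)"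
proof -
  interpret diameter_two_subset V \<rho> D U by unfold_locales (use U in auto)
  have n: "0 < card V" using assms(3) finite_V by (simp add: card_gt_0_iff)
  obtain T where T: "T \<subseteq> U" "clique T"
    "(real (card U))\<^sup>2 \<le> 17 * (real (card (lines2 U)) + 4 * real (card V)) * real (card T)"
    using large_clique[of U "4 * real (card V)"] n card_mono[OF finite_V U(1)] by auto
  have "general_position T"
  proof (rule clique_general_position)
    show "T \<subseteq> V" using T(1) U(1) by simp
    show "\<rho> x y \<le> 1" if "x \<in> T" "y \<in> T" for x y
      using that T(1,2) U(2)[of x y] unfolding clique_def by (metis One_nat_def Suc_1 le_SucE subsetD)
  qed
  then have "real (card T) * (real (card T) - 1) \<le> 2 * real (card lines)"
    using T(1) U(1) by (intro card_general_position) auto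
  moreover have "card (lines2 U) \<le> card lines"
    using lines2_subset[of U] finite_lines by (intro card_mono) auto
  then have "17 * (real (card (lines2 U)) + 4 * real (card V)) * real (card T)
      \<le> 17 * (real (card lines) + 4 * real (card V)) * real (card T)"
    by (intro mult_right_mono mult_left_mono) auto
  ultimately show ?thesis using T(3) by (intro exI[of _ "real (card T)"]) linarith
qed

text \<open>Two points at distance at least three have no common neighbour, so one of them is
  non-adjacent to at least half of the points.\<close>

lemma few_nonadjacent_pairs_bound:
  assumes few: "4 * real (card {(x, y) \<in> V \<times> V. 2 \<le> \<rho> x y}) < (real (card V))\<^sup>2"
  shows "\<exists>\<tau>. (real (card V))\<^sup>2 \<le> 68 * (real (card lines) + 4 * real (card V)) * \<tau> \<and>
    \<tau> * (\<tau> - 1) \<le> 2 * real (card lines)"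
proof -
  have ne: "V \<noteq> {}" using few by auto
  define co where "co x = {y \<in> V. 2 \<le> \<rho> x y}" for x
  define U where "U = {x \<in> V. 2 * card (co x) < card V}"
  have fin: "finite (co x)" for x using finite_V by (simp add: co_def)
  have "\<rho> x y \<le> 2" if xy: "x \<in> U" "y \<in> U" for x y
  proof (rule ccontr)
    assume far: "\<not> \<rho> x y \<le> 2"
    have "V \<subseteq> co x \<union> co y"
    proof
      fix z assume z: "z \<in> V"
      have "\<rho> x y \<le> \<rho> x z + \<rho> y z"
        using dist_triangle[of x z y] dist_sym[of z y] z xy by (simp add: U_def)
      then show "z \<in> co x \<union> co y" using far z by (auto simp: co_def)
    qed
    then have "card V \<le> card (co x \<union> co y)" using fin by (intro card_mono) auto
    also have "\<dots> \<le> card (co x) + card (co y)" by (rule card_Un_le)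
    finally show False using xy by (simp add: U_def)
  qed
  then obtain \<tau> where \<tau>: "(real (card U))\<^sup>2 \<le> 17 * (real (card lines) + 4 * real (card V)) * \<tau>"
    "\<tau> * (\<tau> - 1) \<le> 2 * real (card lines)"
    using diameter_two_bound[of U] ne by (auto simp: U_def)
  \<comment> \<open>Each point outside \<open>U\<close> has at least \<open>n/2\<close> non-adjacent
    partners, while there are fewer than \<open>n^2/4\<close> such ordered pairs. So
    \<open>U\<close> has more than \<open>n/2\<close> points, and squaring this turns 17 into
    68.\<close>
  have "(card V - card U) * card V = (\<Sum>x\<in>V - U. card V)"
    using finite_V by (simp add: card_Diff_subset U_def)
  also have "\<dots> \<le> (\<Sum>x\<in>V - U. 2 * card (co x))"
    by (intro sum_mono) (auto simp: U_def)
  also have "\<dots> \<le> (\<Sum>x\<in>V. 2 * card (co x))"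
    using finite_V by (intro sum_mono2) auto
  also have "\<dots> = 2 * card (SIGMA x:V. co x)"
    using finite_V fin by (simp add: sum_distrib_left)
  also have "(SIGMA x:V. co x) = {(x, y) \<in> V \<times> V. 2 \<le> \<rho> x y}"
    by (auto simp: co_def)
  finally have "real ((card V - card U) * card V) \<le> real (2 * card {(x, y) \<in> V \<times> V. 2 \<le> \<rho> x y})"
    by (simp only: of_nat_le_iff)
  moreover have "card U \<le> card V" using finite_V by (intro card_mono) (auto simp: U_def)
  ultimately have "(real (card V) - real (card U)) * real (card V)
      \<le> 2 * real (card {(x, y) \<in> V \<times> V. 2 \<le> \<rho> x y})"
    by (simp add: of_nat_diff)
  then have "2 * (real (card V) - real (card U)) * real (card V) < (real (card V))\<^sup>2"
    using few by linarith
  then have "real (card V) * (2 * (real (card V) - real (card U)) - real (card V)) < 0"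
    by (simp add: power2_eq_square algebra_simps)
  then have "real (card V) \<le> 2 * real (card U)"
    by (auto simp: mult_less_0_iff)
  then have "(real (card V))\<^sup>2 \<le> (2 * real (card U))\<^sup>2" by (intro power_mono) auto
  also have "\<dots> \<le> 4 * (17 * (real (card lines) + 4 * real (card V)) * \<tau>)"
    using \<tau>(1) by (simp only: power_mult_distrib) simp
  finally show ?thesis using \<tau>(2) by (intro exI[of _ \<tau>]) (simp only: mult.assoc[symmetric], simp)
qed

end

section \<open>Asymptotics\<close>

text \<open>If \<open>N < c * x powr (4/3)\<close>, the first inequality forces
  \<open>\<tau> \<ge> A x\<close>, where \<open>A x\<close> grows like
  \<open>x powr (2/3) / (K * c)\<close>. The second would then give
  \<open>1 / (K * c)^2 \<le> 2 * c\<close> in the limit, contrary to \<open>less\<close>. From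
  \<open>1 \<le> A x\<close> comes the monotonicity of \<open>\<tau> * (\<tau> - 1)\<close>.\<close>

lemma eventually_clique_bound:
  fixes c K :: real
  assumes c: "0 < c" and K: "0 < K" and less: "2 * K\<^sup>2 * c ^ 3 < 1"
  shows "\<forall>\<^sub>F x in at_top. \<forall>N \<tau>. 0 \<le> N \<longrightarrow> x\<^sup>2 \<le> K * (N + 4 * x) * \<tau> \<longrightarrow> \<tau> * (\<tau> - 1) \<le> 2 * N \<longrightarrow>
    c * x powr (4/3) \<le> N"
proof -
  define A where "A x = x\<^sup>2 / (K * (c * x powr (4/3) + 4 * x))" for x :: real
  have "((\<lambda>x. A x * (A x - 1) / x powr (4/3)) \<longlongrightarrow> 1 / (K * c)\<^sup>2) at_top"
    unfolding A_def using c K by (real_asymp simp: power2_eq_square field_simps)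
  moreover have "2 * c < 1 / (K * c)\<^sup>2"
    using less c K by (simp add: field_simps power2_eq_square power3_eq_cube)
  ultimately have "\<forall>\<^sub>F x in at_top. 2 * c < A x * (A x - 1) / x powr (4/3)"
    by (rule order_tendstoD(1))
  moreover have "\<forall>\<^sub>F x in at_top. 1 \<le> A x"
    unfolding A_def using c K by real_asymp
  ultimately show ?thesis
    using eventually_gt_at_top[of 0]
  proof eventually_elim
    case (elim x)
    show ?case
    proof (intro allI impI)
      fix N \<tau> :: real
      assume N: "0 \<le> N" and h: "x\<^sup>2 \<le> K * (N + 4 * x) * \<tau>" "\<tau> * (\<tau> - 1) \<le> 2 * N"
      show "c * x powr (4/3) \<le> N"
      proof (rule ccontr)
        assume n: "\<not> c * x powr (4/3) \<le> N"
        have "A x \<le> x\<^sup>2 / (K * (N + 4 * x))"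
          unfolding A_def using n N K elim by (intro divide_left_mono mult_left_mono mult_pos_pos) auto
        also have "\<dots> \<le> \<tau>" using h(1) N K elim by (subst pos_divide_le_eq) (auto simp: mult.commute)
        finally have "A x \<le> \<tau>" .
        then have "A x * (A x - 1) \<le> \<tau> * (\<tau> - 1)" using elim by (intro mult_mono) auto
        then have "A x * (A x - 1) < 2 * (c * x powr (4/3))" using h(2) n by linarith
        then show False using elim by (simp add: field_simps)
      qed
    qed
  qed
qed

lemma powr_const: "(1 / 8 / sqrt 2) powr (2/3) = 2 powr (-7/3 :: real)"
proof -
  have "(1 / 8 / sqrt 2 :: real) = 2 powr (- 7/2)"
  proof -
    have "(1 / 8 / sqrt 2 :: real) = 2 powr (-3) / 2 powr (1/2)"
      by (simp add: powr_minus powr_half_sqrt)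
    also have "\<dots> = 2 powr (- 7/2)" by (subst powr_diff[symmetric]) simp
    finally show ?thesis .
  qed
  then show ?thesis by (simp add: powr_powr)
qed

text \<open>Solves \<open>t^2/8 \<le> N + sqrt 2 * N powr (3/2)\<close> for \<open>N\<close> after
  replacing the lower-order \<open>N\<close> by \<open>2 powr (-7/3) * t powr (4/3)\<close>; a
  larger \<open>N\<close> needs no argument. \<open>max 0\<close> keeps the base of
  \<open>powr\<close> non-negative for small \<open>t\<close>.\<close>

definition main_coeff :: "real \<Rightarrow> real" where
  "main_coeff t = (max 0 ((1/8 - 2 powr (-7/3) * t powr (-2/3)) / sqrt 2)) powr (2/3)"

lemma main_coeff_tendsto: "(main_coeff \<longlongrightarrow> 2 powr (-7/3)) at_top"
proof -
  have "((\<lambda>t::real. t powr (-2/3)) \<longlongrightarrow> 0) at_top" by real_asymp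
  then have "(main_coeff \<longlongrightarrow> (max 0 ((1/8 - 2 powr (-7/3) * 0) / sqrt 2)) powr (2/3)) at_top"
    unfolding main_coeff_def by (intro tendsto_intros) auto
  then show ?thesis using powr_const by simp
qed

lemma main_coeff_le: "main_coeff t \<le> 2 powr (-7/3)"
proof -
  have "(1/8 - 2 powr (-7/3) * t powr (-2/3)) / sqrt 2 \<le> 1 / 8 / sqrt 2"
    by (intro divide_right_mono) auto
  then have "main_coeff t \<le> (1 / 8 / sqrt 2) powr (2/3)"
    unfolding main_coeff_def by (intro powr_mono2) (simp_all del: divide_divide_eq_left)
  then show ?thesis by (simp only: powr_const)
qed

lemma main_coeff_bound:
  fixes t N :: real
  assumes t: "0 < t" and N: "0 \<le> N" and le: "t\<^sup>2 / 8 \<le> N * (1 + sqrt (2 * N))"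
  shows "main_coeff t * t powr (4/3) \<le> N"
proof (cases "2 powr (-7/3) * t powr (4/3) \<le> N")
  case True
  have "main_coeff t * t powr (4/3) \<le> 2 powr (-7/3) * t powr (4/3)"
    by (intro mult_right_mono main_coeff_le) simp
  then show ?thesis using True by simp
next
  case False
  define e where "e = (1/8 - 2 powr (-7/3) * t powr (-2/3)) / sqrt 2"
  have t2: "t\<^sup>2 = t powr 2" "t powr (4/3) = t\<^sup>2 * t powr (-2/3)"
    using t by (simp_all add: powr_add[symmetric] powr_numeral[symmetric] del: powr_numeral)
  have "sqrt 2 * e = 1/8 - 2 powr (-7/3) * t powr (-2/3)" by (simp add: e_def)
  then have "t\<^sup>2 * (sqrt 2 * e) = t\<^sup>2 / 8 - 2 powr (-7/3) * t powr (4/3)"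
    unfolding t2(2) by (simp only: right_diff_distrib) simp
  also have "\<dots> \<le> sqrt 2 * (N * sqrt N)"
    using le False by (simp add: real_sqrt_mult algebra_simps)
  finally have "t\<^sup>2 * e \<le> N * sqrt N" by (simp add: mult.left_commute)
  moreover have "0 \<le> N * sqrt N" using N by simp
  ultimately have "t\<^sup>2 * max 0 e \<le> N * sqrt N" by (auto simp: max_def)
  also have "N * sqrt N = N powr (3/2)"
    using N by (cases "N = 0") (simp_all add: powr_half_sqrt[symmetric] powr_mult_base)
  finally have "(t\<^sup>2 * max 0 e) powr (2/3) \<le> (N powr (3/2)) powr (2/3)"
    by (intro powr_mono2) auto
  also have "\<dots> = N" using N by (simp add: powr_powr)
  also have "(t\<^sup>2 * max 0 e) powr (2/3) = t powr (4/3) * main_coeff t"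
    using t by (simp add: powr_mult t2(1) powr_powr main_coeff_def e_def del: powr_numeral)
  finally show ?thesis by (simp add: mult.commute)
qed

section \<open>The metric of a connected graph\<close>

context pair_graph begin

lemma length_awalk_to_apath:
  assumes "awalk u p v"
  shows "length (awalk_to_apath p) \<le> length p"
  using assms
proof (induction rule: awalk_to_apath_induct)
  case (path p)
  then have "awalk_to_apath p = p" by (auto simp: awalk_to_apath.simps)
  then show ?case by simp
next
  case (decomp p q r s)
  obtain "p = q @ r @ s" by (rule awalk_cyc_decompE[OF decomp(2,1,3)])
  then show ?case using step_awalk_to_apath[OF decomp(1-3)] decomp(4) by simp
qed

text \<open>Distances are minima over paths without repeated vertices, but concatenated geodesics
  are only walks; shortening them bridges the gap.\<close>

lemma graph_dist_le_awalk:
  assumes "awalk u p v"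
  shows "graph_dist G u v \<le> length p"
proof -
  have "apath u (awalk_to_apath p) v" using assms by (rule apath_awalk_to_apath)
  then have "graph_dist G u v \<le> length (awalk_to_apath p)"
    unfolding graph_dist_def by (intro cInf_lower) auto
  also have "\<dots> \<le> length p" using assms by (rule length_awalk_to_apath)
  finally show ?thesis .
qed

lemma graph_dist_awalk:
  assumes "connected G" "u \<in> pverts G" "v \<in> pverts G"
  obtains p where "awalk u p v" "length p = graph_dist G u v"
proof -
  have "strongly_connected G"
    using assms(1) pair_sym_arcs by (rule symmetric_connected_imp_strongly_connected[rotated])
  then have "u \<rightarrow>\<^sup>*\<^bsub>with_proj G\<^esub> v" using assms by (auto simp: strongly_connected_def)
  then obtain p where "apath u p v" by (auto simp: reachable_apath)
  then have "graph_dist G u v \<in> {length p | p. apath u p v}"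
    unfolding graph_dist_def by (intro Inf_nat_def1) auto
  then show ?thesis using that by (auto simp: apath_def)
qed

lemma geodesic_metric_graph_dist:
  assumes con: "connected G" and D: "graph_diameter G \<le> D"
  shows "geodesic_metric (pverts G) (graph_dist G) D"
proof
  show "finite (pverts G)" by (rule pair_finite_verts)
next
  fix x y assume xy: "x \<in> pverts G" "y \<in> pverts G"
  show "graph_dist G x y = 0 \<longleftrightarrow> x = y"
  proof
    assume "graph_dist G x y = 0"
    then show "x = y" using graph_dist_awalk[OF con xy] by (auto simp: awalk_Nil_iff)
  next
    assume "x = y"
    then show "graph_dist G x y = 0" using graph_dist_le_awalk[of x "[]" y] xy by (auto simp: awalk_Nil_iff)
  qed
  have le: "graph_dist G v u \<le> graph_dist G u v" if uv: "u \<in> pverts G" "v \<in> pverts G" for u v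
  proof -
    obtain p where p: "awalk u p v" "length p = graph_dist G u v"
      by (rule graph_dist_awalk[OF con uv])
    then have "awalk v (rev_path p) u" by simp
    moreover have "length (rev_path p) = length p" by (induction p) auto
    ultimately show ?thesis using graph_dist_le_awalk[of v "rev_path p" u] p by simp
  qed
  then show "graph_dist G x y = graph_dist G y x" using xy by (simp add: le_antisym)
  have "finite {graph_dist G u v | u v. u \<in> pverts G \<and> v \<in> pverts G}"
    using pair_finite_verts
    by (intro finite_image_set2) auto
  then have "graph_dist G x y \<le> graph_diameter G"
    unfolding graph_diameter_def using xy by (intro Max_ge) auto
  then show "graph_dist G x y \<le> D" using D by simp
next
  fix x y z assume xyz: "x \<in> pverts G" "y \<in> pverts G" "z \<in> pverts G"
  obtain p where p: "awalk x p y" "length p = graph_dist G x y"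
    by (rule graph_dist_awalk[OF con xyz(1,2)])
  obtain q where q: "awalk y q z" "length q = graph_dist G y z"
    by (rule graph_dist_awalk[OF con xyz(2,3)])
  have "awalk x (p @ q) z" using p(1) q(1) by (rule awalk_appendI)
  then show "graph_dist G x z \<le> graph_dist G x y + graph_dist G y z"
    using graph_dist_le_awalk[of x "p @ q" z] p q by simp
next
  fix x y assume xy: "x \<in> pverts G" "y \<in> pverts G" "x \<noteq> y"
  obtain p where p: "awalk x p y" "length p = graph_dist G x y"
    by (rule graph_dist_awalk[OF con xy(1,2)])
  then obtain e q where e: "p = e # q" using xy(3) by (cases p) (auto simp: awalk_Nil_iff)
  obtain z where z: "e = (x, z)" "(x, z) \<in> parcs G" "awalk z q y"
    using p(1) e by (cases e) (auto simp: awalk_Cons_iff)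
  have zV: "z \<in> pverts G" using z(2) by (rule in_arcsD2)
  have xz: "graph_dist G x z \<le> 1"
    using graph_dist_le_awalk[of x "[(x, z)]" z] z(2) xy(1) zV
    by (auto simp: awalk_Cons_iff awalk_Nil_iff)
  have zy: "graph_dist G z y \<le> length q" using z(3) by (rule graph_dist_le_awalk)
  obtain p1 where p1: "awalk x p1 z" "length p1 = graph_dist G x z"
    by (rule graph_dist_awalk[OF con xy(1) zV])
  obtain p2 where p2: "awalk z p2 y" "length p2 = graph_dist G z y"
    by (rule graph_dist_awalk[OF con zV xy(2)])
  \<comment> \<open>The first edge and the rest of \<open>p\<close> bound the two distances by 1 and
    \<open>length q\<close>; their sum is at least \<open>1 + length q\<close>, so both bounds are
    attained.\<close>
  have "awalk x (p1 @ p2) y" using p1(1) p2(1) by (rule awalk_appendI)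
  then have "graph_dist G x y \<le> graph_dist G x z + graph_dist G z y"
    using graph_dist_le_awalk[of x "p1 @ p2" y] p1 p2 by simp
  then have "graph_dist G x z = 1 \<and> graph_dist G x y = Suc (graph_dist G z y)"
    using xz zy p(2) e by auto
  then show "\<exists>z\<in>pverts G. graph_dist G x z = 1 \<and> graph_dist G x y = Suc (graph_dist G z y)"
    using zV by blast
qed

end

section \<open>An error term uniform in the diameter bound\<close>

theorem mainTheorem7:
  shows "\<exists>f :: real \<Rightarrow> real. (f \<longlongrightarrow> 0) at_top \<and>
    (\<forall>(G :: 'a pair_pre_digraph) (n :: nat) (D :: nat).
       pair_graph G \<and> Digraph_Component.connected (with_proj G) \<and>
       card (pverts G) = n \<and> 0 < D \<and> graph_diameter G \<le> D \<longrightarrow>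
       real (card (metric_lines (pverts G) (graph_dist G)))
         \<ge> (2 powr (- 7 / 3) - f (real n / real D)) * (real n / real D) powr (4 / 3))"
proof -
  define c :: real where "c = 2 powr (-7/3)"
  have c_pos: "0 < c" by (simp add: c_def)
  have c3: "c ^ 3 = 1 / 128"
  proof -
    have "c ^ 3 = 2 powr (-7)" by (simp add: c_def powr_power)
    then show ?thesis by (simp add: powr_minus)
  qed
  \<comment> \<open>For \<open>D \<ge> d\<close> the gain \<open>n \<ge> d * t\<close> lowers the
    coefficient required in terms of \<open>n\<close> to \<open>c / d powr (4/3)\<close>, and
    \<open>c ^ 3 = 1/128\<close> turns the condition into \<open>2 * K^2 < 128 * d^4\<close>. It
    holds for \<open>K = 17\<close>, \<open>d = 2\<close> (578 < 2048) and for
    \<open>K = 68\<close>, \<open>d = 3\<close> (9248 < 10368).\<close>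
  have scaled: "2 * K\<^sup>2 * (c / d powr (4/3)) ^ 3 < 1" if "2 * K\<^sup>2 < 128 * d ^ 4" "0 < d" for K d :: real
  proof -
    have "(d powr (4/3)) ^ 3 = d ^ 4" using that(2) by (simp add: powr_power)
    then show ?thesis using that by (simp add: power_divide c3)
  qed
  have "\<forall>\<^sub>F x in at_top. c * x powr (4/3) \<le> x * (x - 1) / 2"
    unfolding c_def by real_asymp
  moreover have "\<forall>\<^sub>F x in at_top. \<forall>N \<tau>. 0 \<le> N \<longrightarrow> x\<^sup>2 \<le> 17 * (N + 4 * x) * \<tau> \<longrightarrow>
      \<tau> * (\<tau> - 1) \<le> 2 * N \<longrightarrow> c / 2 powr (4/3) * x powr (4/3) \<le> N"
    using c_pos by (intro eventually_clique_bound scaled) auto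
  moreover have "\<forall>\<^sub>F x in at_top. \<forall>N \<tau>. 0 \<le> N \<longrightarrow> x\<^sup>2 \<le> 68 * (N + 4 * x) * \<tau> \<longrightarrow>
      \<tau> * (\<tau> - 1) \<le> 2 * N \<longrightarrow> c / 3 powr (4/3) * x powr (4/3) \<le> N"
    using c_pos by (intro eventually_clique_bound scaled) auto
  ultimately have "\<forall>\<^sub>F x in at_top. c * x powr (4/3) \<le> x * (x - 1) / 2 \<and>
      (\<forall>N \<tau>. 0 \<le> N \<longrightarrow> x\<^sup>2 \<le> 17 * (N + 4 * x) * \<tau> \<longrightarrow>
        \<tau> * (\<tau> - 1) \<le> 2 * N \<longrightarrow> c / 2 powr (4/3) * x powr (4/3) \<le> N) \<and>
      (\<forall>N \<tau>. 0 \<le> N \<longrightarrow> x\<^sup>2 \<le> 68 * (N + 4 * x) * \<tau> \<longrightarrow>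
        \<tau> * (\<tau> - 1) \<le> 2 * N \<longrightarrow> c / 3 powr (4/3) * x powr (4/3) \<le> N)"
    by eventually_elim blast
  then obtain x0 where x0: "\<And>x. x0 \<le> x \<Longrightarrow> c * x powr (4/3) \<le> x * (x - 1) / 2"
    "\<And>x N \<tau>. x0 \<le> x \<Longrightarrow> 0 \<le> N \<Longrightarrow> x\<^sup>2 \<le> 17 * (N + 4 * x) * \<tau> \<Longrightarrow>
        \<tau> * (\<tau> - 1) \<le> 2 * N \<Longrightarrow> c / 2 powr (4/3) * x powr (4/3) \<le> N"
    "\<And>x N \<tau>. x0 \<le> x \<Longrightarrow> 0 \<le> N \<Longrightarrow> x\<^sup>2 \<le> 68 * (N + 4 * x) * \<tau> \<Longrightarrow>
        \<tau> * (\<tau> - 1) \<le> 2 * N \<Longrightarrow> c / 3 powr (4/3) * x powr (4/3) \<le> N"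
    unfolding eventually_at_top_linorder by blast
  \<comment> \<open>Below \<open>x0\<close> the value \<open>c\<close> reduces the claim to a lower
    bound of 0, so a single \<open>f\<close> serves all graphs and all \<open>D\<close>.\<close>
  define f where "f t = (if t < x0 then c else c - main_coeff t)" for t
  have "((\<lambda>t. c - main_coeff t) \<longlongrightarrow> c - c) at_top"
    using main_coeff_tendsto by (intro tendsto_diff) (auto simp: c_def)
  then have "((\<lambda>t. c - main_coeff t) \<longlongrightarrow> 0) at_top" by simp
  moreover have "\<forall>\<^sub>F t in at_top. c - main_coeff t = f t"
    using eventually_ge_at_top[of x0] by eventually_elim (simp add: f_def)
  ultimately have "(f \<longlongrightarrow> 0) at_top" by (rule Lim_transform_eventually)
  moreover have "(c - f (real n / real D)) * (real n / real D) powr (4/3)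
      \<le> real (card (metric_lines (pverts G) (graph_dist G)))"
    if G: "pair_graph G" "Digraph_Component.connected (with_proj G)" "card (pverts G) = n"
      "0 < D" "graph_diameter G \<le> D" for G :: "'a pair_pre_digraph" and n D
  proof -
    interpret geodesic_metric "pverts G" "graph_dist G" D
      using G by (intro pair_graph.geodesic_metric_graph_dist)
    define t where "t = real n / real D"
    define N where "N = real (card lines)"
    have N: "0 \<le> N" by (simp add: N_def)
    have ne: "pverts G \<noteq> {}"
      using G(2) by (auto simp: Digraph_Component.connected_def strongly_connected_def)
    then have n: "0 < n" using G(3) finite_V by (metis card_gt_0_iff)
    have t: "0 < t" "t \<le> real n" "real n = t * real D"
      using n G(4) by (auto simp: t_def field_simps)
    have t_powr: "t powr (4/3) = real n powr (4/3) / real D powr (4/3)"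
      unfolding t_def by (simp add: powr_divide)
    have "main_coeff t * t powr (4/3) \<le> N" if large: "x0 \<le> t"
    proof -
      have n_large: "x0 \<le> real n" using large t(2) by simp
      have suffices: ?thesis if "c * t powr (4/3) \<le> N"
        using that mult_right_mono[OF main_coeff_le[of t], of "t powr (4/3)"] by (simp add: c_def)
      have clique: ?thesis if "c / d powr (4/3) * real n powr (4/3) \<le> N" "0 < d" "d \<le> real D" for d
      proof (rule suffices)
        have "d powr (4/3) \<le> real D powr (4/3)" using that by (intro powr_mono2) auto
        then have "c * real n powr (4/3) / real D powr (4/3) \<le> c * real n powr (4/3) / d powr (4/3)"
          using c_pos that(2) G(4) by (intro divide_left_mono mult_nonneg_nonneg mult_pos_pos) auto
        then have "c * t powr (4/3) \<le> c / d powr (4/3) * real n powr (4/3)"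
          by (simp add: t_powr)
        then show "c * t powr (4/3) \<le> N" using that(1) by simp
      qed
      consider "D = 1" | "D = 2" | "3 \<le> D" using G(4) by linarith
      then show ?thesis
      proof cases
        case 1
        have "general_position (pverts G)"
          using dist_le_diam 1 by (intro clique_general_position) auto
        then have "real n * (real n - 1) / 2 \<le> N"
          using card_general_position[of "pverts G"] G(3) by (simp add: N_def)
        then show ?thesis using x0(1)[OF n_large] 1 by (intro clique[of 1]) auto
      next
        case 2
        then show ?thesis
          using diameter_two_bound[of "pverts G"] dist_le_diam ne x0(2)[OF n_large N] G(3)
          by (intro clique[of 2]) (auto simp: N_def)
      next
        case 3
        let ?P = "real (card {(x, y) \<in> pverts G \<times> pverts G. 2 \<le> graph_dist G x y})"
        show ?thesis
        proof (cases "4 * ?P < (real n)\<^sup>2")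
          case True
          then show ?thesis
            using few_nonadjacent_pairs_bound x0(3)[OF n_large N] G(3) 3
            by (intro clique[of 3]) (auto simp: N_def)
        next
          case False
          have "(t * real D)\<^sup>2 \<le> 4 * (2 * (real D)\<^sup>2 * N * (1 + sqrt (2 * N)))"
            using False card_nonadjacent_pairs[OF 3] t(3) by (simp add: N_def)
          then have "(real D)\<^sup>2 * t\<^sup>2 \<le> (real D)\<^sup>2 * (8 * (N * (1 + sqrt (2 * N))))"
            by (simp add: power_mult_distrib algebra_simps)
          then have "t\<^sup>2 / 8 \<le> N * (1 + sqrt (2 * N))" using G(4) by simp
          then show ?thesis by (rule main_coeff_bound[OF t(1) N])
        qed
      qed
    qed
    then show ?thesis using N by (auto simp: f_def t_def N_def)
  qed
  ultimately show ?thesis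
    by (intro exI[of _ f]) (auto simp: c_def)
qed

end
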